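(* Let $p$ be a prime and let $\nu$ be a positive integer. Let $n$ be a positive integer such that $p\nmid n$. Then, for all integers $k\ge 0$, the number of Hermitian complementary dual cyclic codes of length $np^k$ over $\mathbb{F}_{p^{2\nu}}$ equals the number of Hermitian complementary dual cyclic codes of length $n$ over $\mathbb{F}_{p^{2\nu}}$, which is equal to $$2^{\sum_{d\mid n}\lambda(d,p^\nu)\frac{\Phi(d)}{\mathrm{ord}_d(p^{2\nu})}+\frac12\sum_{d\mid n}\left(1-\lambda(d,p^\nu)\right)\frac{\Phi(d)}{\mathrm{ord}_d(p^{2\nu})}},$$ where $\Phi$ is the Euler totient function.
   Context: A cyclic code of length $m$ over $\mathbb{F}_{p^{2\nu}}$ is an ideal of the group algebra $\mathbb{F}_{p^{2\nu}}[\mathbb{Z}_m]\cong \mathbb{F}_{p^{2\nu}}[X]/(X^m-1)$, regarded as a subspace of $\mathbb{F}_{p^{2\nu}}^m$. With $\langle u,v\rangle_{\rm H}=\sum_i u_iv_i^{p^\nu}$ and $C^{\perp_{\rm H}}=\{v : \langle c,v\rangle_{\rm H}=0\ \forall c\in C\}$, a code $C$ is Hermitian complementary dual if $C\cap C^{\perp_{\rm H}}=\{0\}$. $\mathrm{ord}_d(m)$ denotes the multiplicative order of $m$ modulo $d$ (equal to $1$ for $d=1$). $\lambda(d,p^\nu)=1$ if there exists an odd positive integer $i$ such that $d\mid (p^{\nu i}+1)$, and $\lambda(d,p^\nu)=0$ otherwise. *)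

theory Defs
  imports "Jordan_Normal_Form.Matrix" "HOL-Algebra.Ideal" "HOL-Number_Theory.Number_Theory"
begin

text \<open>
  The group algebra \<open>F[Z_m]\<close> on the space \<open>F^m\<close>: the vector \<open>u\<close> stands for
  \<open>\<Sum>i<m. u $ i \<cdot> X^i\<close> with \<open>X^m = 1\<close>, so the product is cyclic convolution.
\<close>

definition cyclic_algebra :: "nat \<Rightarrow> 'a :: comm_ring_1 vec ring" where
  "cyclic_algebra m =
    \<lparr> carrier = carrier_vec m,
      monoid.mult = (\<lambda>u v. vec m (\<lambda>k. \<Sum>i<m. \<Sum>j<m. if (i + j) mod m = k then u $ i * v $ j else 0)),
      one = vec m (\<lambda>i. if i = 0 then 1 else 0),
      ring.zero = 0\<^sub>v m,
      add = (+) \<rparr>"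

text \<open>
  The locale \<^locale>\<open>ideal\<close> contains the ring axioms for the ambient structure; they hold here for
  every \<open>m\<close>, so \<open>cyclic_code\<close> below imposes nothing beyond the ideal property.
\<close>

lemma cring_cyclic_algebra: "cring (cyclic_algebra m :: 'a :: comm_ring_1 vec ring)"
proof -
  let ?R = "cyclic_algebra m :: 'a vec ring"
  define f where "f = (\<lambda>(u :: 'a vec) v k. \<Sum>i<m. \<Sum>j<m. if (i + j) mod m = k then u $ i * v $ j else 0)"
  have R: "carrier ?R = carrier_vec m" "\<zero>\<^bsub>?R\<^esub> = 0\<^sub>v m"
    "\<one>\<^bsub>?R\<^esub> = vec m (\<lambda>i. if i = 0 then 1 else 0)" "x \<oplus>\<^bsub>?R\<^esub> y = x + y"
    "x \<otimes>\<^bsub>?R\<^esub> y = vec m (f x y)" for x y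
    by (simp_all add: cyclic_algebra_def f_def)
  have commute: "f u v k = f v u k" for u v k
    unfolding f_def by (subst sum.swap) (simp add: ac_simps cong: if_cong)
  have left: "f (vec m (f u v)) w l =
      (\<Sum>i<m. \<Sum>j<m. \<Sum>h<m. if (i + j + h) mod m = l then u $ i * v $ j * w $ h else 0)" for u v w l
  proof -
    have "f (vec m (f u v)) w l = (\<Sum>k<m. \<Sum>h<m. \<Sum>i<m. \<Sum>j<m.
        if (i + j) mod m = k then (if (k + h) mod m = l then u $ i * v $ j * w $ h else 0) else 0)"
      unfolding f_def
      by (intro sum.cong refl) (auto simp: sum_distrib_right intro!: sum.cong, auto intro!: sum.neutral)
    also have "\<dots> = (\<Sum>k<m. \<Sum>i<m. \<Sum>j<m. \<Sum>h<m.
        if (i + j) mod m = k then (if (k + h) mod m = l then u $ i * v $ j * w $ h else 0) else 0)"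
      by (rule sum.cong[OF refl], subst sum.swap, rule sum.cong[OF refl], rule sum.swap)
    also have "\<dots> = (\<Sum>i<m. \<Sum>j<m. \<Sum>h<m. \<Sum>k<m.
        if (i + j) mod m = k then (if (k + h) mod m = l then u $ i * v $ j * w $ h else 0) else 0)"
      by (subst sum.swap, rule sum.cong[OF refl], subst sum.swap, rule sum.cong[OF refl], rule sum.swap)
    also have "\<dots> = (\<Sum>i<m. \<Sum>j<m. \<Sum>h<m. if (i + j + h) mod m = l then u $ i * v $ j * w $ h else 0)"
      by (intro sum.cong refl) (auto simp: sum.delta mod_add_left_eq)
    finally show ?thesis .
  qed
  have right: "f u (vec m (f v w)) l =
      (\<Sum>i<m. \<Sum>j<m. \<Sum>h<m. if (i + j + h) mod m = l then u $ i * v $ j * w $ h else 0)" for u v w l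
  proof -
    have "f u (vec m (f v w)) l = f (vec m (f v w)) u l" by (rule commute)
    also have "\<dots> = (\<Sum>j<m. \<Sum>h<m. \<Sum>i<m. if (j + h + i) mod m = l then v $ j * w $ h * u $ i else 0)"
      by (rule left)
    also have "\<dots> = (\<Sum>j<m. \<Sum>i<m. \<Sum>h<m. if (j + h + i) mod m = l then v $ j * w $ h * u $ i else 0)"
      by (rule sum.cong[OF refl], rule sum.swap)
    also have "\<dots> = (\<Sum>i<m. \<Sum>j<m. \<Sum>h<m. if (j + h + i) mod m = l then v $ j * w $ h * u $ i else 0)"
      by (rule sum.swap)
    finally show ?thesis by (simp add: ac_simps cong: if_cong)
  qed
  have one: "f (vec m (\<lambda>i. if i = 0 then 1 else 0)) v k = v $ k" if "k < m" for v k
  proof -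
    have "f (vec m (\<lambda>i. if i = 0 then 1 else 0)) v k =
      (\<Sum>i<m. if i = 0 then (\<Sum>j<m. if j = k then v $ j else 0) else 0)"
      unfolding f_def by (intro sum.cong refl) (auto intro!: sum.cong, auto intro!: sum.neutral)
    with that show ?thesis by (simp add: sum.delta)
  qed
  have distrib: "f (u + v) w k = f u w k + f v w k"
    if "v \<in> carrier_vec m" "w \<in> carrier_vec m" for u v w k
    using that unfolding f_def sum.distrib[symmetric]
    by (intro sum.cong refl) (auto simp: algebra_simps)
  show ?thesis
  proof (rule cringI)
    show "abelian_group ?R"
    proof (rule abelian_groupI)
      fix x assume "x \<in> carrier ?R"
      thus "\<exists>y\<in>carrier ?R. y \<oplus>\<^bsub>?R\<^esub> x = \<zero>\<^bsub>?R\<^esub>"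
        by (intro bexI[of _ "- x"]) (auto simp: R)
    qed (auto simp: R comm_add_vec[of _ m])
    show "comm_monoid ?R"
      by (rule comm_monoidI) (auto simp: R left right one intro!: eq_vecI commute)
  qed (auto simp: R distrib intro!: eq_vecI)
qed

definition cyclic_code :: "nat \<Rightarrow> 'a :: field vec set \<Rightarrow> bool" where
  "cyclic_code m C \<longleftrightarrow> ideal C (cyclic_algebra m)"

text \<open>Over a field with \<open>q\<^sup>2\<close> elements, \<open>x \<mapsto> x ^ q\<close> is the conjugation.\<close>

definition hermitian_inner :: "nat \<Rightarrow> nat \<Rightarrow> 'a :: field vec \<Rightarrow> 'a vec \<Rightarrow> 'a" where
  "hermitian_inner q m u v = (\<Sum>i<m. u $ i * (v $ i) ^ q)"

definition hermitian_dual :: "nat \<Rightarrow> nat \<Rightarrow> 'a :: field vec set \<Rightarrow> 'a vec set" where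
  "hermitian_dual q m C = {v \<in> carrier_vec m. \<forall>c\<in>C. hermitian_inner q m c v = 0}"

definition hermitian_complementary_dual :: "nat \<Rightarrow> nat \<Rightarrow> 'a :: field vec set \<Rightarrow> bool" where
  "hermitian_complementary_dual q m C \<longleftrightarrow> C \<inter> hermitian_dual q m C = {0\<^sub>v m}"

definition hcd_cyclic_codes :: "nat \<Rightarrow> nat \<Rightarrow> 'a :: field vec set set" where
  "hcd_cyclic_codes q m = {C. cyclic_code m C \<and> hermitian_complementary_dual q m C}"

definition lambda_ind :: "nat \<Rightarrow> nat \<Rightarrow> nat" where
  "lambda_ind d q = (if \<exists>i. odd i \<and> d dvd q ^ i + 1 then 1 else 0)"

end

(*
  Write R = F[X]/(X^m - 1), with the involution "star" that conjugates coefficients and sends X to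
  X^(-1). The Hermitian inner product of u and v is the constant coefficient of u * star v, so the
  dual of an ideal C is star (Ann C). If C meets its dual trivially, then C also meets Ann C
  trivially; a generator g of C is therefore coprime to (X^m - 1) / g, and Bezout yields an
  idempotent e generating C, which must satisfy star e = e. So the codes in question correspond to
  the star-invariant idempotents of R.

  For m = n p^k, the p^k-th power map sends invariant idempotents modulo X^n - 1 to those modulo
  X^m - 1 and is inverse to reduction modulo X^n - 1.

  For p not dividing n, (star e)^q = e(X^(-q)) as polynomials, so the invariant idempotents are
  the idempotents of the algebra B of elements with u(X^(-q)) = u. Every u in B satisfies
  u^(q^2) = u, so B is a power of F, and its dimension is the number of orbits of multiplication
  by -q on Z_n, namely the sum over d dividing n of Phi(d) / ord_d(-q). Finally ord_d(-q) is
  ord_d(q^2) or twice that, according to whether lambda(d, q) is 1 or 0.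
*)
theory Submission
  imports Defs "HOL-Computational_Algebra.Polynomial"
begin

section \<open>Polynomials modulo \<open>X\<^sup>m - 1\<close>\<close>

lemma finite_field_power_card:
  fixes x :: "'a :: {field, finite}"
  shows "x ^ card (UNIV :: 'a set) = x"
proof (cases "x = 0")
  case False
  have pos: "card (UNIV :: 'a set) > 0"
    by (simp add: card_gt_0_iff)
  \<comment> \<open>Multiplication by a nonzero x permutes the nonzero elements, so their product
    may be cancelled.\<close>
  have "(\<Prod>y\<in>UNIV-{0}. y) = (\<Prod>y\<in>UNIV-{0}. x * y)"
    by (rule prod.reindex_bij_witness[of _ "\<lambda>y. x * y" "\<lambda>y. y / x"]) (use False in auto)
  also have "\<dots> = x ^ (card (UNIV :: 'a set) - 1) * (\<Prod>y\<in>UNIV-{0}. y)"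
    by (simp add: prod.distrib)
  finally have "x ^ (card (UNIV :: 'a set) - 1) = 1"
    by simp
  thus ?thesis
    using pos by (metis Suc_diff_1 mult.right_neutral power_Suc)
qed (simp add: card_gt_0_iff)

text \<open>With Q elements in the field, both sides are monic of degree Q, since Q is at least 2.
  Their difference has degree below Q but vanishes at all Q elements, hence is zero.\<close>

lemma prod_linear_factors_finite_field:
  "(\<Prod>c\<in>UNIV. [:0, 1:] - [:c:]) =
    monom 1 (card (UNIV :: 'a :: {field, finite} set)) - [:0, 1:: 'a :]"
proof (rule ccontr)
  let ?Q = "card (UNIV :: 'a set)"
  let ?A = "\<Prod>c\<in>UNIV. [:- c, 1 :: 'a :]" and ?B = "monom 1 ?Q - [:0, 1:: 'a :]"
  have "card {0, 1 :: 'a} \<le> ?Q"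
    by (intro card_mono) auto
  hence Q: "?Q \<ge> 2" by simp
  assume "\<not> ?thesis"
  hence neq: "?A - ?B \<noteq> 0" by simp
  have degA: "degree ?A = ?Q"
    by (subst degree_prod_eq_sum_degree) auto
  have leadA: "coeff ?A ?Q = 1"
    using degA lead_coeff_prod[of "\<lambda>c. [:- c, 1 :: 'a :]" UNIV] by simp
  have "degree (?A - ?B) < ?Q"
  proof (rule degree_lessI)
    show "\<forall>k\<ge>?Q. coeff (?A - ?B) k = 0"
    proof (intro allI impI)
      fix k assume k: "k \<ge> ?Q"
      show "coeff (?A - ?B) k = 0"
      proof (cases "k = ?Q")
        case True
        thus ?thesis using leadA Q by (simp add: coeff_pCons split: nat.split)
      next
        case False
        thus ?thesis using k degA Q
          by (auto simp: coeff_eq_0 coeff_pCons split: nat.split)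
      qed
    qed
  qed (use neq in auto)
  moreover have "poly (?A - ?B) x = 0" for x
  proof -
    have "poly ?A x = 0" by (auto simp: poly_prod)
    thus ?thesis by (simp add: poly_monom finite_field_power_card)
  qed
  hence "card {x. poly (?A - ?B) x = 0} = ?Q" by simp
  ultimately show False
    using card_poly_roots_bound[OF neq] by simp
qed

text \<open>A nonzero member of least degree divides the others, because remainders stay in I. The
  lemma serves both for the ideal of a code and for the ideal generated by two polynomials, where it
  supplies Bezout's identity.\<close>

lemma poly_ideal_principal:
  fixes I :: "'a :: field poly set"
  assumes add: "\<And>f g. f \<in> I \<Longrightarrow> g \<in> I \<Longrightarrow> f + g \<in> I"
    and mult: "\<And>f g. f \<in> I \<Longrightarrow> f * g \<in> I"
    and p: "p \<in> I" "p \<noteq> 0"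
  obtains g where "g \<in> I" "g \<noteq> 0" "\<And>f. f \<in> I \<Longrightarrow> g dvd f"
proof -
  obtain g where g: "g \<in> I \<and> g \<noteq> 0"
    and least: "\<And>f. f \<in> I \<and> f \<noteq> 0 \<Longrightarrow> degree g \<le> degree f"
    using ex_has_least_nat[of "\<lambda>f. f \<in> I \<and> f \<noteq> 0" p degree] p by auto
  show ?thesis
  proof (rule that[of g])
    fix f assume f: "f \<in> I"
    have "f mod g = f + g * (- (f div g))"
      by (simp add: minus_div_mult_eq_mod[symmetric] mult.commute)
    hence "f mod g \<in> I"
      using f g add mult by metis
    thus "g dvd f"
      using least[of "f mod g"] degree_mod_less'[of g f] g
      by (metis mod_eq_0_iff_dvd not_le)
  qed (use g in auto)
qed

section \<open>Congruences modulo X^m - 1 and substitution of powers of X\<close>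

definition circ_poly :: "nat \<Rightarrow> 'a :: comm_ring_1 poly" where
  "circ_poly m = monom 1 m - 1"

lemma degree_circ_poly: "m > 0 \<Longrightarrow> degree (circ_poly m :: 'a :: comm_ring_1 poly) = m"
  using degree_add_eq_left[of "- 1" "monom 1 m :: 'a poly"]
  by (simp add: circ_poly_def degree_monom_eq)

lemma circ_poly_nonzero [simp]: "m > 0 \<Longrightarrow> circ_poly m \<noteq> (0 :: 'a :: comm_ring_1 poly)"
  using degree_circ_poly[of m, where 'a = 'a] by auto

lemma degree_mod_circ_poly:
  "m > 0 \<Longrightarrow> degree (f mod circ_poly m :: 'a :: field poly) < m"
  by (metis circ_poly_nonzero degree_0 degree_circ_poly degree_mod_less)

lemma mod_circ_poly_eq_iff:
  "m > 0 \<Longrightarrow> f mod circ_poly m = f \<longleftrightarrow> degree (f :: 'a :: field poly) < m"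
  by (metis degree_mod_circ_poly degree_circ_poly mod_poly_less)

lemma cong_monom_one: "[monom 1 m = 1] (mod (circ_poly m :: 'a :: field poly))"
  by (simp add: cong_iff_dvd_diff circ_poly_def)

lemma cong_monom_mod:
  "[monom c i = monom c (i mod m)] (mod (circ_poly m :: 'a :: field poly))"
proof -
  have "monom c i = monom c (i mod m) * monom 1 m ^ (i div m)"
    by (simp add: monom_power mult_monom)
  also have "[\<dots> = monom c (i mod m) * 1 ^ (i div m)] (mod circ_poly m)"
    by (intro cong_mult cong_pow cong_monom_one cong_refl)
  finally show ?thesis by simp
qed

lemma cong_monom:
  assumes "[i = j] (mod m)"
  shows "[monom c i = monom c j] (mod (circ_poly m :: 'a :: field poly))"
  using cong_monom_mod[of c i m] cong_monom_mod[of c j m] assms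
  by (simp add: cong_def)

text \<open>Replacing each exponent by its residue modulo m stays in the same class and already
  gives degree below m, so it computes the remainder. Cyclic convolution and the Hermitian form are
  both read off in this way.\<close>

lemma coeff_sum_monom_mod:
  assumes "m > 0" "k < m"
  shows "coeff ((\<Sum>i\<in>S. monom (a i) (t i)) mod circ_poly m) k =
    (\<Sum>i\<in>S. if t i mod m = k then a i else (0 :: 'a :: field))"
proof -
  let ?g = "\<Sum>i\<in>S. monom (a i) (t i mod m)"
  have "[(\<Sum>i\<in>S. monom (a i) (t i)) = ?g] (mod circ_poly m)"
    by (intro cong_sum cong_monom_mod)
  moreover have "degree ?g < m"
    using assms by (intro degree_sum_less) (auto intro: le_less_trans[OF degree_monom_le])
  ultimately have "(\<Sum>i\<in>S. monom (a i) (t i)) mod circ_poly m = ?g"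
    using assms by (metis cong_def mod_circ_poly_eq_iff)
  thus ?thesis
    by (simp add: coeff_sum coeff_monom)
qed

lemma circ_poly_dvd: "circ_poly m dvd (circ_poly (m * k) :: 'a :: field poly)"
  using cong_pow[OF cong_monom_one[of m, where 'a = 'a], of k]
  by (simp add: cong_iff_dvd_diff circ_poly_def monom_power)

lemma pcompose_monom_circ_poly:
  "pcompose (circ_poly m) (monom 1 t) = (circ_poly (m * t) :: 'a :: field poly)"
proof -
  have "pcompose (monom 1 m) (monom 1 t) = (monom 1 (m * t) :: 'a poly)"
    by (induction m) (simp_all add: monom_Suc pcompose_pCons mult_monom monom_0)
  thus ?thesis by (simp add: circ_poly_def pcompose_diff pcompose_1)
qed

lemma pcompose_monom_monom:
  "pcompose (monom c i) (monom 1 t) = monom (c :: 'a :: comm_semiring_1) (i * t)"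
  by (induction i) (simp_all add: monom_Suc pcompose_pCons mult_monom monom_0)

lemma pcompose_pcompose_monom:
  "pcompose (pcompose f (monom 1 s)) (monom 1 t) = pcompose (f :: 'a :: comm_ring_1 poly) (monom 1 (s * t))"
  by (simp flip: pcompose_assoc add: pcompose_monom_monom)

text \<open>As X^m = 1 in the quotient, exponents matter only modulo m. Hence \<open>m - 1\<close>
  and \<open>(m - 1) * q\<close> can play the roles of -1 and -q.\<close>

lemma pcompose_cong_exponent:
  assumes "[s = t] (mod m)"
  shows "[pcompose f (monom 1 s) = pcompose f (monom 1 t)] (mod (circ_poly m :: 'a :: field poly))"
proof (induction f)
  case (pCons a f)
  show ?case
    unfolding pcompose_pCons
    by (intro cong_add cong_mult cong_monom assms cong_refl pCons.IH)
qed simp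

text \<open>The substitution sends X^m - 1 to X^(m t) - 1, a multiple of X^m - 1, and so is well
  defined on the quotient.\<close>

lemma pcompose_cong_circ_poly:
  assumes "[f = g] (mod (circ_poly m :: 'a :: field poly))"
  shows "[pcompose f (monom 1 t) = pcompose g (monom 1 t)] (mod circ_poly m)"
proof -
  obtain k where "f - g = circ_poly m * k"
    using assms by (auto simp: cong_iff_dvd_diff)
  hence "pcompose f (monom 1 t) - pcompose g (monom 1 t) = circ_poly (m * t) * pcompose k (monom 1 t)"
    by (metis pcompose_diff pcompose_mult pcompose_monom_circ_poly)
  thus ?thesis
    using circ_poly_dvd[of m t, where 'a = 'a] by (simp add: cong_iff_dvd_diff)
qed

lemma cong_iff_eq_of_degree_less:
  assumes "m > 0" "degree f < m" "degree g < m"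
  shows "[f = g] (mod (circ_poly m :: 'a :: field poly)) \<longleftrightarrow> f = g"
  using assms mod_circ_poly_eq_iff[of m f] mod_circ_poly_eq_iff[of m g] by (auto simp: cong_def)

lemma finite_degree_less: "finite {f :: 'a :: {zero, finite} poly. degree f < m}"
proof (rule finite_subset)
  have "f \<in> Poly ` {xs. set xs \<subseteq> UNIV \<and> length xs \<le> m}" if "degree f < m" for f :: "'a poly"
  proof (rule image_eqI[of _ _ "coeffs f"])
    show "coeffs f \<in> {xs. set xs \<subseteq> UNIV \<and> length xs \<le> m}"
      using that by (simp add: coeffs_def)
  qed simp
  thus "{f :: 'a poly. degree f < m} \<subseteq> Poly ` {xs. set xs \<subseteq> UNIV \<and> length xs \<le> m}"
    by blast
  show "finite (Poly ` {xs :: 'a list. set xs \<subseteq> UNIV \<and> length xs \<le> m})"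
    by (intro finite_imageI finite_lists_length_le) simp
qed

lemma idempotent_power:
  assumes "[e * e = e] (mod c)" "k > 0"
  shows "[e ^ k = e] (mod (c :: 'a :: unique_euclidean_ring))"
  using assms(2)
proof (induction k rule: nat_induct_non_zero)
  case (Suc k)
  have "[e ^ Suc k = e * e] (mod c)"
    using cong_scalar_left[OF Suc.IH, of e] by simp
  thus ?case using assms(1) by (rule cong_trans)
qed simp

lemma poly_eq_sum_monom:
  "degree u < m \<Longrightarrow> u = (\<Sum>i<m. monom (coeff u i) i)" for u :: "'b :: comm_monoid_add poly"
  by (rule poly_eqI) (simp add: coeff_sum coeff_eq_0)

section \<open>Star-invariant idempotents\<close>

text \<open>The first assumption makes the q-th power map additive, the second makes it an
  involution of the field.\<close>

locale hermitian_field =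
  fixes q :: nat and field_type :: "'a :: {field, finite} itself"
  assumes q_power_CHAR: "\<exists>\<nu>. q = CHAR('a) ^ \<nu>"
    and card_field: "card (UNIV :: 'a set) = q\<^sup>2"
begin

section \<open>The Frobenius map and conjugation of coefficients\<close>

lemma prime_CHAR: "prime CHAR('a)"
  by (rule prime_CHAR_semidom) (rule finite_imp_CHAR_pos, simp)

lemma q_pos: "q > 0"
  using card_field finite_UNIV_card_ge_0[where ?'a = 'a] by (cases q) auto

lemma q_gt_1: "q > 1"
proof -
  have "card {0, 1 :: 'a} \<le> q\<^sup>2"
    unfolding card_field[symmetric] by (intro card_mono) auto
  thus ?thesis using q_pos by (cases "q = 1") auto
qed

lemma frob_add: "(x + y :: 'a) ^ q = x ^ q + y ^ q"
  using q_power_CHAR freshmans_dream'[OF prime_CHAR] by metis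

lemma frob_add_poly: "(f + g :: 'a poly) ^ q = f ^ q + g ^ q"
  using q_power_CHAR freshmans_dream'[where 'a = "'a poly"] prime_CHAR by (metis semiring_char_poly)

lemma frob_sum: "(\<Sum>i\<in>A. h i :: 'a) ^ q = (\<Sum>i\<in>A. h i ^ q)"
  using q_power_CHAR freshmans_dream_sum'[OF prime_CHAR] by metis

lemma frob_frob: "((x :: 'a) ^ q) ^ q = x"
  using finite_field_power_card[of x] by (simp add: card_field power2_eq_square power_mult)

definition conj_poly :: "'a poly \<Rightarrow> 'a poly" where
  "conj_poly f = map_poly (\<lambda>a. a ^ q) f"

lemma coeff_conj_poly [simp]: "coeff (conj_poly f) i = coeff f i ^ q"
  using q_pos by (simp add: conj_poly_def coeff_map_poly)

lemma conj_poly_add: "conj_poly (f + g) = conj_poly f + conj_poly g"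
  by (rule poly_eqI) (simp add: frob_add)

lemma conj_poly_mult: "conj_poly (f * g) = conj_poly f * conj_poly g"
  by (rule poly_eqI) (simp add: coeff_mult frob_sum power_mult_distrib)

lemma conj_poly_monom: "conj_poly (monom a i) = monom (a ^ q) i"
  using q_pos by (simp add: conj_poly_def map_poly_monom)

lemma conj_poly_1 [simp]: "conj_poly 1 = 1"
  by (simp add: conj_poly_def)

lemma conj_poly_0 [simp]: "conj_poly 0 = 0"
  by (simp add: conj_poly_def)

lemma conj_poly_conj_poly [simp]: "conj_poly (conj_poly f) = f"
  by (rule poly_eqI) (simp add: frob_frob)

lemma conj_poly_pcompose: "conj_poly (pcompose f g) = pcompose (conj_poly f) (conj_poly g)"
proof (induction f)
  case (pCons a f)
  have "conj_poly (pCons a f) = pCons (a ^ q) (conj_poly f)"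
    by (rule poly_eqI) (simp add: coeff_pCons split: nat.split)
  moreover have "conj_poly [:a:] = [:a ^ q:]"
    using conj_poly_monom[of a 0] by (simp add: monom_0)
  ultimately show ?case
    by (simp add: pcompose_pCons conj_poly_add conj_poly_mult pCons.IH)
qed simp

lemma conj_poly_circ_poly: "conj_poly (circ_poly m) = circ_poly m"
proof -
  have "conj_poly (circ_poly m) + 1 = circ_poly m + 1"
    using conj_poly_add[of "circ_poly m" 1] by (simp add: circ_poly_def conj_poly_monom)
  thus ?thesis by simp
qed

text \<open>The q-th power is additive on polynomials too, so it acts on each monomial separately:
  the coefficient is conjugated and the exponent multiplied by q.\<close>

lemma frob_poly: "f ^ q = pcompose (conj_poly f) (monom 1 q)"
proof (induction f)
  case 0
  thus ?case using q_pos by simp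
next
  case (pCons a f)
  have "pCons a f = [:a:] + monom 1 1 * f"
    by (simp add: monom_altdef)
  hence "pCons a f ^ q = [:a:] ^ q + monom 1 q * f ^ q"
    by (simp add: frob_add_poly power_mult_distrib monom_power)
  also have "[:a:] ^ q = [:a ^ q:]"
    using monom_power[of a 0 q] by (simp add: monom_0)
  also have "conj_poly (pCons a f) = pCons (a ^ q) (conj_poly f)"
    by (rule poly_eqI) (simp add: coeff_pCons split: nat.split)
  hence "[:a ^ q:] + monom 1 q * f ^ q = pcompose (conj_poly (pCons a f)) (monom 1 q)"
    by (simp add: pcompose_pCons pCons.IH)
  finally show ?case .
qed

lemma frob_frob_poly: "f ^ q\<^sup>2 = pcompose f (monom 1 (q\<^sup>2))" for f :: "'a poly"
proof -
  have "f ^ q\<^sup>2 = (f ^ q) ^ q"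
    by (simp add: power2_eq_square power_mult)
  also have "\<dots> = pcompose f (monom 1 (q\<^sup>2))"
    by (simp add: frob_poly[of f] frob_poly[of "pcompose f g" for f g] conj_poly_pcompose
        conj_poly_monom pcompose_pcompose_monom power2_eq_square)
  finally show ?thesis .
qed

text \<open>The exponent \<open>m - 1\<close> stands for -1, so this is an involution only modulo
  \<open>circ_poly m\<close>.\<close>

definition star :: "nat \<Rightarrow> 'a poly \<Rightarrow> 'a poly" where
  "star m f = pcompose (conj_poly f) (monom 1 (m - 1))"

lemma star_add: "star m (f + g) = star m f + star m g"
  by (simp add: star_def conj_poly_add pcompose_add)

lemma star_mult: "star m (f * g) = star m f * star m g"
  by (simp add: star_def conj_poly_mult pcompose_mult)

lemma star_1 [simp]: "star m 1 = 1"
  by (simp add: star_def pcompose_1)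

lemma star_0 [simp]: "star m 0 = 0"
  by (simp add: star_def)

lemma star_diff: "star m (f - g) = star m f - star m g"
  using star_add[of m "f - g" g] by (simp add: algebra_simps)

lemma star_power: "star m (f ^ k) = star m f ^ k"
  by (induction k) (simp_all add: star_mult)

lemma star_sum: "star m (\<Sum>i\<in>A. h i) = (\<Sum>i\<in>A. star m (h i))"
  by (induction A rule: infinite_finite_induct) (simp_all add: star_add)

lemma star_monom: "star m (monom a i) = monom (a ^ q) (i * (m - 1))"
  by (simp add: star_def conj_poly_monom pcompose_monom_monom)

lemma star_cong:
  assumes "[f = g] (mod circ_poly m)"
  shows "[star m f = star m g] (mod circ_poly m)"
proof -
  have "[conj_poly f = conj_poly g] (mod circ_poly m)"
  proof -
    obtain k where "f = g + circ_poly m * k"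
      using assms by (metis add.commute cong_iff_dvd_diff diff_add_cancel dvdE)
    hence "conj_poly f = conj_poly g + circ_poly m * conj_poly k"
      by (simp add: conj_poly_add conj_poly_mult conj_poly_circ_poly)
    thus ?thesis by (simp add: cong_iff_dvd_diff)
  qed
  thus ?thesis unfolding star_def by (rule pcompose_cong_circ_poly)
qed

lemma star_star:
  assumes "m > 0"
  shows "[star m (star m f) = f] (mod circ_poly m)"
proof -
  have "star m (star m f) = pcompose f (monom 1 ((m - 1) * (m - 1)))"
    by (simp add: star_def conj_poly_pcompose conj_poly_monom pcompose_pcompose_monom)
  also have "[(m - 1) * (m - 1) = 1] (mod m)"
  proof (cases "m = 1")
    case False
    then obtain j where "m = j + 2" using assms by (metis add.commute add_2_eq_Suc not0_implies_Suc One_nat_def neq0_conv)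
    hence "(m - 1) * (m - 1) = 1 + j * m" by (simp add: algebra_simps)
    thus ?thesis by (metis cong_def mod_mult_self1)
  qed simp
  hence "[pcompose f (monom 1 ((m - 1) * (m - 1))) = pcompose f (monom 1 1)] (mod circ_poly m)"
    by (rule pcompose_cong_exponent)
  also have "pcompose f (monom 1 1) = f"
    by (simp add: monom_altdef)
  finally show ?thesis .
qed

text \<open>The q-th power conjugates the coefficients a second time and so undoes the conjugation
  in \<open>star\<close>. What remains is the F-linear substitution of X^(-q) for X.\<close>

lemma star_frob: "star m f ^ q = pcompose f (monom 1 ((m - 1) * q))"
  unfolding frob_poly[of "star m f"]
  by (simp add: star_def conj_poly_pcompose conj_poly_monom pcompose_pcompose_monom)

section \<open>Invariant idempotents for the lengths n and n p^k\<close>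

definition selfdual_idempotents :: "nat \<Rightarrow> 'a poly set" where
  "selfdual_idempotents m =
    {e. degree e < m \<and> [e * e = e] (mod circ_poly m) \<and> [star m e = e] (mod circ_poly m)}"

text \<open>The set holds one representative of each class, the remainder of degree below m. This
  lemma carries the conditions from any representative to that one.\<close>

lemma mod_circ_poly_in_selfdual_idempotents:
  assumes "m > 0" "[e * e = e] (mod circ_poly m)" "[star m e = e] (mod circ_poly m)"
  shows "e mod circ_poly m \<in> selfdual_idempotents m"
proof -
  have e: "[e mod circ_poly m = e] (mod circ_poly m)" by simp
  have "[(e mod circ_poly m) * (e mod circ_poly m) = e] (mod circ_poly m)"
    using cong_mult[OF e e] assms(2) by (rule cong_trans)
  moreover have "[star m (e mod circ_poly m) = e] (mod circ_poly m)"
    using star_cong[OF e] assms(3) by (rule cong_trans)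
  ultimately show ?thesis
    using assms(1) by (simp add: selfdual_idempotents_def degree_mod_circ_poly cong_def)
qed

lemma cong_circ_poly_dvd:
  "[f = g] (mod circ_poly (n * j)) \<Longrightarrow> [f = g] (mod (circ_poly n :: 'a poly))"
  using circ_poly_dvd cong_dvd_modulus by blast

lemma circ_poly_CHAR_power: "circ_poly n ^ (CHAR('a) ^ k) = (circ_poly (n * CHAR('a) ^ k) :: 'a poly)"
proof -
  have "(circ_poly n + 1 :: 'a poly) ^ (CHAR('a) ^ k) = circ_poly n ^ (CHAR('a) ^ k) + 1"
    using freshmans_dream'[where 'a = "'a poly", of "CHAR('a) ^ k" k "circ_poly n" 1] prime_CHAR by simp
  thus ?thesis by (simp add: circ_poly_def monom_power algebra_simps)
qed

text \<open>The power map is additive and sends multiples of X^n - 1 to multiples of its p^k-th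
  power, which is X^(n p^k) - 1. Thus it lifts congruences to the larger modulus.\<close>

lemma power_CHAR_cong:
  assumes "[f = g] (mod (circ_poly n :: 'a poly))"
  shows "[f ^ (CHAR('a) ^ k) = g ^ (CHAR('a) ^ k)] (mod circ_poly (n * CHAR('a) ^ k))"
proof -
  obtain h where "f = g + circ_poly n * h"
    using assms by (metis add.commute cong_iff_dvd_diff diff_add_cancel dvdE)
  hence "f ^ (CHAR('a) ^ k) = g ^ (CHAR('a) ^ k) + circ_poly (n * CHAR('a) ^ k) * h ^ (CHAR('a) ^ k)"
    using freshmans_dream'[where 'a = "'a poly", of "CHAR('a) ^ k" k g "circ_poly n * h"] prime_CHAR
    by (simp add: power_mult_distrib circ_poly_CHAR_power)
  thus ?thesis by (simp add: cong_iff_dvd_diff)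
qed

text \<open>Both exponents, \<open>n * j - 1\<close> and \<open>n - 1\<close>, represent -1 modulo
  n.\<close>

lemma star_mult_cong:
  assumes "n > 0" "j > 0"
  shows "[star (n * j) f = star n f] (mod circ_poly n)"
proof -
  have "n * j - 1 = (n - 1) + (j - 1) * n"
    using assms by (cases n; cases j) (auto simp: algebra_simps)
  hence "[n * j - 1 = n - 1] (mod n)"
    by (metis cong_def mod_mult_self1)
  thus ?thesis unfolding star_def by (rule pcompose_cong_exponent)
qed

text \<open>An idempotent equals its j-th power, for either modulus. Therefore lifting by the j-th
  power and reducing modulo X^n - 1 cancel in both orders.\<close>

lemma card_selfdual_idempotents_CHAR_power:
  assumes n: "n > 0"
  shows "card (selfdual_idempotents (n * CHAR('a) ^ k)) = card (selfdual_idempotents n)"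
proof -
  define j m where "j = CHAR('a) ^ k" and "m = n * j"
  have j: "j > 0" using prime_CHAR by (auto simp: j_def prime_gt_0_nat)
  hence m: "m > 0" using n by (simp add: m_def)
  have lift: "[f ^ j = g ^ j] (mod circ_poly m)" if "[f = g] (mod circ_poly n)" for f g :: "'a poly"
    using power_CHAR_cong[OF that] by (simp add: j_def m_def)
  have drop: "[f = g] (mod circ_poly n)" if "[f = g] (mod circ_poly m)" for f g :: "'a poly"
    using that cong_circ_poly_dvd by (simp add: m_def)
  have "bij_betw (\<lambda>f. f ^ j mod circ_poly m) (selfdual_idempotents n) (selfdual_idempotents m)"
  proof (rule bij_betw_byWitness[of _ "\<lambda>e. e mod circ_poly n"])
    show "\<forall>f\<in>selfdual_idempotents n. f ^ j mod circ_poly m mod circ_poly n = f"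
    proof
      fix f assume "f \<in> selfdual_idempotents n"
      hence f: "degree f < n" "[f * f = f] (mod circ_poly n)"
        by (auto simp: selfdual_idempotents_def)
      have "[f ^ j mod circ_poly m = f ^ j] (mod circ_poly n)"
        by (rule drop) simp
      also have "[f ^ j = f] (mod circ_poly n)"
        using f j by (intro idempotent_power)
      finally show "f ^ j mod circ_poly m mod circ_poly n = f"
        using f n by (simp add: cong_def mod_circ_poly_eq_iff)
    qed
    show "\<forall>e\<in>selfdual_idempotents m. (e mod circ_poly n) ^ j mod circ_poly m = e"
    proof
      fix e assume "e \<in> selfdual_idempotents m"
      hence e: "degree e < m" "[e * e = e] (mod circ_poly m)"
        by (auto simp: selfdual_idempotents_def)
      have "[(e mod circ_poly n) ^ j = e ^ j] (mod circ_poly m)"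
        by (rule lift) simp
      also have "[e ^ j = e] (mod circ_poly m)"
        using e j by (intro idempotent_power)
      finally show "(e mod circ_poly n) ^ j mod circ_poly m = e"
        using e m by (simp add: cong_def mod_circ_poly_eq_iff)
    qed
    show "(\<lambda>f. f ^ j mod circ_poly m) ` selfdual_idempotents n \<subseteq> selfdual_idempotents m"
    proof safe
      fix f assume "f \<in> selfdual_idempotents n"
      hence f: "[f * f = f] (mod circ_poly n)" "[star n f = f] (mod circ_poly n)"
        by (auto simp: selfdual_idempotents_def)
      have "[star m f = f] (mod circ_poly n)"
        using star_mult_cong[OF n j] f(2) unfolding m_def by (rule cong_trans)
      thus "f ^ j mod circ_poly m \<in> selfdual_idempotents m"
        using lift[OF f(1)] m
        by (intro mod_circ_poly_in_selfdual_idempotents) (auto simp: power_mult_distrib star_power lift)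
    qed
    show "(\<lambda>e. e mod circ_poly n) ` selfdual_idempotents m \<subseteq> selfdual_idempotents n"
    proof safe
      fix e assume "e \<in> selfdual_idempotents m"
      hence e: "[e * e = e] (mod circ_poly m)" "[star m e = e] (mod circ_poly m)"
        by (auto simp: selfdual_idempotents_def)
      have "[star n e = e] (mod circ_poly n)"
        using star_mult_cong[OF n j, of e] drop[OF e(2)] unfolding m_def
        by (meson cong_sym cong_trans)
      thus "e mod circ_poly n \<in> selfdual_idempotents n"
        using drop[OF e(1)] n by (intro mod_circ_poly_in_selfdual_idempotents)
    qed
  qed
  thus ?thesis
    unfolding m_def j_def by (metis bij_betw_same_card)
qed

section \<open>The number of idempotents as a function of the size of the algebra\<close>

lemma card_idempotents:
  fixes P :: "'a poly"
  assumes fin: "finite U"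
    and red: "\<And>u. u \<in> U \<Longrightarrow> u mod P = u"
    and add: "\<And>u v. u \<in> U \<Longrightarrow> v \<in> U \<Longrightarrow> u + v \<in> U"
    and smult: "\<And>c u. u \<in> U \<Longrightarrow> smult c u \<in> U"
    and mult: "\<And>u v. u \<in> U \<Longrightarrow> v \<in> U \<Longrightarrow> (u * v) mod P \<in> U"
    and frob: "\<And>u. u \<in> U \<Longrightarrow> [u ^ q\<^sup>2 = u] (mod P)"
    and e: "e \<in> U" "[e * e = e] (mod P)"
  shows "\<exists>M. card {u \<in> U. [e * u = u] (mod P)} = (q\<^sup>2) ^ M \<and>
    card {u \<in> U. [e * u = u] (mod P) \<and> [u * u = u] (mod P)} = 2 ^ M"
  \<comment> \<open>An idempotent strictly below \<open>e\<close> splits \<open>e U\<close> as a product. Without one, \<open>e U\<close> consists of the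
    scalar multiples of \<open>e\<close>: otherwise all \<open>u - c e\<close> would be units of \<open>e U\<close>, while their product
    over the scalars \<open>c\<close> is \<open>e (u ^ q\<^sup>2 - u) = 0\<close>.\<close>
  using e
proof (induction "card {u \<in> U. [e * u = u] (mod P)}" arbitrary: e rule: less_induct)
  case less
  \<comment> \<open>\<open>S e\<close> is the ideal e U and \<open>J e\<close> its set of
    idempotents; the induction is on the size of \<open>S e\<close>.\<close>
  define S where "S e = {u \<in> U. [e * u = u] (mod P)}" for e
  define J where "J e = {u \<in> S e. [u * u = u] (mod P)}" for e
  have eU: "e \<in> U" and ee: "[e * e = e] (mod P)" by (fact less.prems)+
  have finS: "finite (S e)" for e using fin by (simp add: S_def)
  have eqI: "u = v" if "u \<in> U" "v \<in> U" "[u = v] (mod P)" for u v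
    using that red by (metis cong_def)
  have diff: "u - v \<in> U" if "u \<in> U" "v \<in> U" for u v
    using add[OF that(1) smult[OF that(2), of "-1"]] by simp
  have zero: "0 \<in> U" using smult[OF eU, of 0] by simp
  have modmult: "[(u * v) mod P = u * v] (mod P)" for u v by simp
  have IH: "\<exists>M. card (S g) = (q\<^sup>2) ^ M \<and> card (J g) = 2 ^ M"
    if "card (S g) < card (S e)" "g \<in> U" "[g * g = g] (mod P)" for g
    using less.hyps[of g] that by (simp add: S_def J_def conj_ac)
  consider (null) "e = 0" | (split) g where "g \<in> J e" "g \<noteq> 0" "g \<noteq> e"
    | (prim) "e \<noteq> 0" "J e \<subseteq> {0, e}" by blast
  hence "\<exists>M. card (S e) = (q\<^sup>2) ^ M \<and> card (J e) = 2 ^ M"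
  proof cases
    case null
    have "S e = {0}"
      using zero eqI[OF zero] unfolding S_def null by auto
    moreover from this have "J e = {0}" by (auto simp: J_def)
    ultimately show ?thesis by (intro exI[of _ 0]) simp
  next
    case split
    \<comment> \<open>The complement of g in e: g and h are orthogonal idempotents with sum
      e.\<close>
    define h where "h = e - g"
    have gU: "g \<in> U" and eg: "[e * g = g] (mod P)" and gg: "[g * g = g] (mod P)"
      using split by (auto simp: J_def S_def)
    have hU: "h \<in> U" using eU gU diff by (simp add: h_def)
    have hg: "[h * g = 0] (mod P)"
      using cong_diff[OF eg gg] by (simp add: h_def algebra_simps)
    have eh: "[e * h = h] (mod P)"
      using cong_diff[OF ee eg] by (simp add: h_def algebra_simps)
    have hh: "[h * h = h] (mod P)"
      using cong_diff[OF eh hg] by (simp add: h_def algebra_simps)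
    have sub: "S k \<subseteq> S e" if "[e * k = k] (mod P)" for k
    proof
      fix u assume u: "u \<in> S k"
      hence ku: "[k * u = u] (mod P)" by (simp add: S_def)
      have "[e * u = e * (k * u)] (mod P)"
        using ku by (intro cong_scalar_left) (rule cong_sym)
      also have "e * (k * u) = (e * k) * u" by (simp add: mult_ac)
      also have "[(e * k) * u = k * u] (mod P)"
        using that by (rule cong_scalar_right)
      also note ku
      finally show "u \<in> S e" using u by (simp add: S_def)
    qed
    \<comment> \<open>The inclusion is strict because e in \<open>S k\<close> would give k e = e,
      hence k = e.\<close>
    have less_card: "card (S k) < card (S e)" if "[e * k = k] (mod P)" "k \<in> U" "k \<noteq> e" for k
    proof (rule psubset_card_mono)
      have "e \<notin> S k"
      proof
        assume "e \<in> S k"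
        hence "[k * e = e] (mod P)" by (simp add: S_def)
        with that(1) have "[k = e] (mod P)"
          by (metis cong_sym cong_trans mult.commute)
        with eqI that eU show False by blast
      qed
      moreover have "e \<in> S e" using eU ee by (simp add: S_def)
      ultimately show "S k \<subset> S e" using sub[OF that(1)] by blast
    qed (rule finS)
    obtain M1 where M1: "card (S g) = (q\<^sup>2) ^ M1" "card (J g) = 2 ^ M1"
      using IH[OF less_card[OF eg gU split(3)] gU gg] by blast
    have "h \<noteq> e" using split by (simp add: h_def)
    then obtain M2 where M2: "card (S h) = (q\<^sup>2) ^ M2" "card (J h) = 2 ^ M2"
      using IH[OF less_card[OF eh hU] hU hh] by blast
    \<comment> \<open>Adding components and projecting by g and h are inverse to each other, on the
      ideals as well as on their idempotents. Both counts are therefore multiplicative, and the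
      exponents add.\<close>
    let ?f = "\<lambda>(a, b). a + b" and ?i = "\<lambda>u. ((g * u) mod P, (h * u) mod P)"
    have ga: "[g * (a + b) = a] (mod P)" "[h * (a + b) = b] (mod P)" "[a * b = 0] (mod P)"
      if "a \<in> S g" "b \<in> S h" for a b
    proof -
      have a: "[g * a = a] (mod P)" and b: "[h * b = b] (mod P)"
        using that by (auto simp: S_def)
      have 0: "[(g * x) * (h * y) = 0] (mod P)" for x y
        using cong_scalar_right[OF hg, of "x * y"] by (simp add: mult_ac)
      have "[g * b = g * (h * b)] (mod P)"
        using b by (intro cong_scalar_left) (rule cong_sym)
      also have "[g * (h * b) = 0] (mod P)" using 0[of 1 b] by simp
      finally have "[g * b = 0] (mod P)" .
      from cong_add[OF a this] show "[g * (a + b) = a] (mod P)"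
        by (simp add: distrib_left)
      have "[h * a = h * (g * a)] (mod P)"
        using a by (intro cong_scalar_left) (rule cong_sym)
      also have "[h * (g * a) = 0] (mod P)" using 0[of a 1] by (simp add: mult_ac)
      finally have "[h * a = 0] (mod P)" .
      from cong_add[OF this b] show "[h * (a + b) = b] (mod P)"
        by (simp add: distrib_left)
      have "[a * b = (g * a) * (h * b)] (mod P)"
        using a b by (intro cong_mult) (auto intro: cong_sym)
      also note 0
      finally show "[a * b = 0] (mod P)" .
    qed
    have f_in: "a + b \<in> S e" if "a \<in> S g" "b \<in> S h" for a b
    proof -
      have "a \<in> S e" "b \<in> S e" using that sub eg eh by auto
      thus ?thesis using add cong_add[of "e * a" a P "e * b" b] by (simp add: S_def distrib_left)
    qed
    have i_in: "(k * u) mod P \<in> S k" if "k \<in> U" "[k * k = k] (mod P)" "u \<in> S e" for k u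
    proof -
      have "[k * ((k * u) mod P) = k * (k * u)] (mod P)"
        by (intro cong_scalar_left modmult)
      also have "k * (k * u) = (k * k) * u" by (simp add: mult_ac)
      also have "[(k * k) * u = k * u] (mod P)" using that(2) by (rule cong_scalar_right)
      finally show ?thesis using that mult by (simp add: S_def)
    qed
    have fi: "(g * u) mod P + (h * u) mod P = u" if "u \<in> S e" for u
    proof (rule eqI)
      have "[(g * u) mod P + (h * u) mod P = g * u + h * u] (mod P)"
        by (intro cong_add modmult)
      also have "g * u + h * u = e * u" by (simp add: h_def algebra_simps)
      also have "[e * u = u] (mod P)" using that by (simp add: S_def)
      finally show "[(g * u) mod P + (h * u) mod P = u] (mod P)" .
    qed (use that gU hU in \<open>auto simp: S_def intro!: add mult\<close>)
    have i_f: "?i (a + b) = (a, b)" if "a \<in> S g" "b \<in> S h" for a b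
      using ga[OF that] that red by (auto simp: S_def cong_def)
    have "bij_betw ?f (S g \<times> S h) (S e)"
      by (rule bij_betw_byWitness[of _ ?i])
        (use f_in i_in[OF gU gg] i_in[OF hU hh] fi i_f in auto)
    moreover have "bij_betw ?f (J g \<times> J h) (J e)"
    proof (rule bij_betw_byWitness[of _ ?i])
      show "?f ` (J g \<times> J h) \<subseteq> J e"
      proof clarify
        fix a b assume ab: "a \<in> J g" "b \<in> J h"
        have *: "[a * a = a] (mod P)" "[b * b = b] (mod P)" "a \<in> S g" "b \<in> S h"
          using ab by (auto simp: J_def)
        have "(a + b) * (a + b) = a * a + b * b + (a * b + a * b)" by (simp add: algebra_simps)
        also have "[\<dots> = a + b + (0 + 0)] (mod P)"
          by (intro cong_add * ga)
        finally show "a + b \<in> J e"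
          using f_in * by (simp add: J_def)
      qed
      have idem: "(k * u) mod P \<in> J k" if "k \<in> U" "[k * k = k] (mod P)" "u \<in> J e" for k u
      proof -
        have "[(k * u) mod P * ((k * u) mod P) = (k * u) * (k * u)] (mod P)"
          by (intro cong_mult modmult)
        also have "(k * u) * (k * u) = (k * k) * (u * u)" by (simp add: mult_ac)
        also have "[(k * k) * (u * u) = k * u] (mod P)"
          using that by (intro cong_mult) (auto simp: J_def)
        finally show ?thesis using i_in that by (simp add: J_def)
      qed
      show "?i ` J e \<subseteq> J g \<times> J h"
        using idem[OF gU gg] idem[OF hU hh] by auto
    qed (use fi i_f in \<open>auto simp: J_def\<close>)
    ultimately have "card (S e) = card (S g) * card (S h)" "card (J e) = card (J g) * card (J h)"
      by (metis bij_betw_same_card card_cartesian_product)+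
    thus ?thesis
      using M1 M2 by (intro exI[of _ "M1 + M2"]) (simp add: power_add)
  next
    case prim
    let ?Q = "q\<^sup>2"
    have Q: "?Q \<ge> 2"
      using q_gt_1 power_mono[of 2 q 2] by simp
    have e_pow: "[e ^ k = e] (mod P)" if "k > 0" for k
      using idempotent_power[OF ee that] .
    have scalar: "\<exists>c. u = smult c e" if u: "u \<in> S e" for u
    proof (rule ccontr)
      assume no: "\<not> ?thesis"
      define w where "w c = u - smult c e" for c
      have uU: "u \<in> U" and eu: "[e * u = u] (mod P)" using u by (auto simp: S_def)
      have wU: "w c \<in> U" for c using uU eU smult diff by (simp add: w_def)
      have ew: "[e * w c = w c] (mod P)" for c
      proof -
        have "[smult c (e * e) = smult c e] (mod P)"
          using cong_scalar_left[OF ee, of "[:c:]"] by simp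
        from cong_diff[OF eu this] show ?thesis by (simp add: w_def algebra_simps)
      qed
      have wpow: "w c ^ Suc k mod P \<in> U" for c k
      proof (induction k)
        case 0
        thus ?case using wU[of c] red by simp
      next
        case (Suc k)
        have "(w c * (w c ^ Suc k mod P)) mod P = w c ^ Suc (Suc k) mod P"
          by (simp add: mod_mult_right_eq)
        thus ?case using mult[OF wU Suc.IH, of c] by simp
      qed
      \<comment> \<open>From w^Q = w it follows that w^(Q-1) is an idempotent of e U. If it
        vanished, so would w = w^Q, making u a scalar multiple of e; hence it is e, the only nonzero
        idempotent there.\<close>
      have top: "[w c ^ (?Q - 1) = e] (mod P)" for c
      proof -
        obtain j where j: "?Q - 1 = Suc j" using Q by (cases "?Q - 1") auto
        have Qj: "?Q = Suc (Suc j)" using j by simp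
        let ?v = "w c ^ Suc j mod P"
        have "[?v * ?v = w c ^ Suc j * w c ^ Suc j] (mod P)"
          by (intro cong_mult) simp_all
        also have "w c ^ Suc j * w c ^ Suc j = w c ^ ?Q * w c ^ j"
          by (simp only: Qj flip: power_add) simp
        also have "[w c ^ ?Q * w c ^ j = w c * w c ^ j] (mod P)"
          using frob[OF wU] by (rule cong_scalar_right)
        also have "w c * w c ^ j = w c ^ Suc j" by simp
        finally have vv: "[?v * ?v = ?v] (mod P)" by simp
        have "[e * ?v = e * w c ^ Suc j] (mod P)"
          by (intro cong_scalar_left) simp
        also have "e * w c ^ Suc j = (e * w c) * w c ^ j" by (simp add: mult_ac)
        also have "[(e * w c) * w c ^ j = w c * w c ^ j] (mod P)"
          using ew by (rule cong_scalar_right)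
        finally have ev: "[e * ?v = ?v] (mod P)" by simp
        have "?v \<in> J e" using vv ev wpow by (simp add: J_def S_def)
        moreover have "?v \<noteq> 0"
        proof
          assume "?v = 0"
          hence "[w c * w c ^ Suc j = w c * 0] (mod P)"
            by (intro cong_scalar_left) (simp add: cong_def)
          with frob[OF wU[of c]] have "[w c = 0] (mod P)"
            unfolding Qj by (metis cong_sym cong_trans mult_zero_right power_Suc)
          hence "w c = 0" using eqI wU zero by blast
          with no show False by (simp add: w_def)
        qed
        ultimately have "?v = e" using prim by blast
        thus ?thesis using j by (metis cong_mod_left cong_refl)
      qed
      \<comment> \<open>The idempotent e is written as a product of Q copies of itself, one per
        scalar, so that \<open>top\<close> can replace each factor.\<close>
      have "[e = (\<Prod>c\<in>(UNIV :: 'a set). e)] (mod P)"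
        using e_pow[of "card (UNIV :: 'a set)"] q_pos by (simp add: card_field cong_sym_eq)
      also have "[(\<Prod>c\<in>(UNIV :: 'a set). e) = (\<Prod>c\<in>UNIV. w c ^ (?Q - 1))] (mod P)"
        using top by (intro cong_prod) (rule cong_sym)
      also have "(\<Prod>c\<in>UNIV. w c ^ (?Q - 1)) = (\<Prod>c\<in>UNIV. w c) ^ (?Q - 1)"
        by (simp add: prod_power_distrib)
      also have "[(\<Prod>c\<in>UNIV. w c) ^ (?Q - 1) = 0 ^ (?Q - 1)] (mod P)"
      proof (rule cong_pow)
        \<comment> \<open>Modulo P, u - c e is e (u - c). The product is thus a power of e times X^Q
          - X evaluated at u, and \<open>frob\<close> makes the latter vanish.\<close>
        have "[(\<Prod>c\<in>UNIV. w c) = (\<Prod>c\<in>UNIV. e * (u - [:c:]))] (mod P)"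
        proof (rule cong_prod)
          fix c
          have "[e * (u - [:c:]) = w c] (mod P)"
            using cong_diff[OF eu cong_refl[of "smult c e"]] by (simp add: w_def algebra_simps)
          thus "[w c = e * (u - [:c:])] (mod P)" by (rule cong_sym)
        qed
        also have "(\<Prod>c\<in>UNIV. e * (u - [:c:])) =
            e ^ ?Q * pcompose (\<Prod>c\<in>UNIV. [:0, 1:] - [:c:]) u"
          by (simp add: prod.distrib card_field pcompose_prod pcompose_diff pcompose_pCons
              del: diff_pCons)
        also have "pcompose (\<Prod>c\<in>UNIV. [:0, 1:] - [:c:]) u = u ^ ?Q - u"
        proof -
          have "pcompose (monom (1 :: 'a) k) u = u ^ k" for k
            by (induction k) (simp_all add: monom_Suc pcompose_pCons monom_0)
          thus ?thesis
            unfolding prod_linear_factors_finite_field card_field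
            by (simp add: pcompose_diff pcompose_pCons)
        qed
        also have "[e ^ ?Q * (u ^ ?Q - u) = e ^ ?Q * 0] (mod P)"
          using cong_diff[OF frob[OF uU] cong_refl[of u]] by (intro cong_scalar_left) simp
        finally show "[(\<Prod>c\<in>UNIV. w c) = 0] (mod P)" by simp
      qed
      also have "(0 :: 'a poly) ^ (?Q - 1) = 0" using Q by simp
      finally show False using eqI[OF eU zero] prim by blast
    qed
    have smult_e: "smult c e \<in> S e" for c
      using cong_scalar_left[OF ee, of "[:c:]"] smult[OF eU] by (simp add: S_def)
    have "S e = range (\<lambda>c. smult c e)" using scalar smult_e by blast
    moreover have "inj (\<lambda>c. smult c e)"
    proof (rule injI)
      fix c d assume "smult c e = smult d e"
      hence "smult (c - d) e = 0" by (simp add: smult_diff_left)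
      thus "c = d" using prim by simp
    qed
    ultimately have "card (S e) = ?Q"
      by (simp add: card_image card_field)
    moreover have "J e = {0, e}"
      using prim smult_e[of 0] smult_e[of 1] ee by (auto simp: J_def)
    hence "card (J e) = 2" using prim by simp
    ultimately show ?thesis by (intro exI[of _ 1]) simp
  qed
  thus ?case by (simp add: S_def J_def conj_ac)
qed

end

section \<open>Orbits of a multiplication on residues\<close>

definition mult_orbit :: "nat \<Rightarrow> nat \<Rightarrow> nat \<Rightarrow> nat set" where
  "mult_orbit m r i = range (\<lambda>t. (i * r ^ t) mod m)"

definition mult_orbits :: "nat \<Rightarrow> nat \<Rightarrow> nat set set" where
  "mult_orbits m r = mult_orbit m r ` {..<m}"

lemma mult_orbit_subset: "m > 0 \<Longrightarrow> mult_orbit m r i \<subseteq> {..<m}"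
  by (auto simp: mult_orbit_def)

lemma mult_orbit_self: "i < m \<Longrightarrow> i \<in> mult_orbit m r i"
  by (auto simp: mult_orbit_def intro!: image_eqI[of _ _ 0])

text \<open>Orbits are built from natural powers of r, so returning from j to i needs an inverse of
  r^t. With o' the order of r modulo m, \<open>r ^ (t * (o' - 1))\<close> is one.\<close>

lemma mult_orbit_eq:
  assumes "coprime m r" "j \<in> mult_orbit m r i"
  shows "mult_orbit m r j = mult_orbit m r i"
proof -
  have sub: "mult_orbit m r j \<subseteq> mult_orbit m r i" if j: "j \<in> mult_orbit m r i" for i j
  proof -
    obtain t where t: "j = (i * r ^ t) mod m" using j unfolding mult_orbit_def by (elim rangeE)
    have "(j * r ^ s) mod m = (i * r ^ (t + s)) mod m" for s
      unfolding t by (simp only: mod_mult_left_eq power_add mult.assoc)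
    thus ?thesis by (auto simp: mult_orbit_def)
  qed
  obtain t where t: "j = (i * r ^ t) mod m" using assms(2) unfolding mult_orbit_def by (elim rangeE)
  define o' where "o' = ord m r"
  have o': "o' > 0" using assms by (simp add: o'_def)
  have "[r ^ (t * o') = 1] (mod m)"
    using cong_pow[OF ord[of r m], of t] by (simp add: o'_def mult.commute flip: power_mult)
  hence "[i * r ^ (t * o') = i * 1] (mod m)"
    by (rule cong_scalar_left)
  moreover have split: "t * o' = t + t * (o' - 1)"
    using o' by (cases o') auto
  have "(j * r ^ (t * (o' - 1))) mod m = (i * r ^ (t * o')) mod m"
    unfolding t split by (simp only: mod_mult_left_eq power_add mult.assoc)
  ultimately have i: "i mod m = (j * r ^ (t * (o' - 1))) mod m"
    by (simp add: cong_def)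
  have "(i * r ^ s) mod m = (j * r ^ (t * (o' - 1) + s)) mod m" for s
  proof -
    have "(i * r ^ s) mod m = ((i mod m) * r ^ s) mod m"
      by (simp only: mod_mult_left_eq)
    also have "\<dots> = (j * r ^ (t * (o' - 1) + s)) mod m"
      unfolding i by (simp only: mod_mult_left_eq power_add mult.assoc)
    finally show ?thesis .
  qed
  hence "mult_orbit m r i \<subseteq> mult_orbit m r j"
    by (auto simp: mult_orbit_def)
  with sub[OF assms(2)] show ?thesis by blast
qed

text \<open>Cancelling g = gcd i m shows that i x and i y agree modulo m exactly when x and y agree
  modulo d = m / g. The orbit thus has as many elements as there are powers of r modulo d.\<close>

lemma card_mult_orbit:
  assumes "m > 0" "coprime m r"
  shows "card (mult_orbit m r i) = ord (m div gcd i m) r"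
proof -
  define g d i' where "g = gcd i m" and "d = m div g" and "i' = i div g"
  have g: "g > 0" "m = g * d" "i = g * i'"
    using assms by (auto simp: g_def d_def i'_def)
  have cop: "coprime i' d"
    using assms(1) div_gcd_coprime[of i m] by (simp add: g_def d_def i'_def)
  have d: "d > 0" using g assms by (metis gr0I mult_0_right)
  have cop_r: "coprime d r"
    using assms(2) g(2) by (simp add: coprime_mult_left_iff)
  have eq_iff: "(i * x) mod m = (i * y) mod m \<longleftrightarrow> x mod d = y mod d" for x y
  proof -
    have "(i * x) mod m = (i * y) mod m \<longleftrightarrow> (i' * x) mod d = (i' * y) mod d"
      using g(1) by (simp add: g(2,3) mult.assoc flip: mult_mod_right)
    also have "\<dots> \<longleftrightarrow> x mod d = y mod d"
      using cong_mult_lcancel_nat[of i' d x y] cop by (simp add: cong_def)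
    finally show ?thesis .
  qed
  have pos: "ord d r > 0" using cop_r by simp
  have "mult_orbit m r i = (\<lambda>t. (i * r ^ t) mod m) ` {..<ord d r}"
  proof (rule antisym)
    have "(i * r ^ t) mod m = (i * r ^ (t mod ord d r)) mod m" for t
    proof -
      have "[r ^ t = r ^ (t mod ord d r)] (mod d)"
      proof -
        have "r ^ t = (r ^ ord d r) ^ (t div ord d r) * r ^ (t mod ord d r)"
          by (simp flip: power_mult power_add)
        also have "[\<dots> = 1 ^ (t div ord d r) * r ^ (t mod ord d r)] (mod d)"
          by (intro cong_mult cong_pow ord cong_refl)
        finally show ?thesis by simp
      qed
      thus ?thesis using eq_iff by (simp add: cong_def)
    qed
    thus "mult_orbit m r i \<subseteq> (\<lambda>t. (i * r ^ t) mod m) ` {..<ord d r}"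
      using pos by (auto simp: mult_orbit_def intro!: image_eqI[of _ _ "t mod ord d r" for t])
  qed (auto simp: mult_orbit_def)
  moreover have "inj_on (\<lambda>t. (i * r ^ t) mod m) {..<ord d r}"
    using inj_power_mod[OF cop_r] by (simp add: inj_on_def eq_iff)
  ultimately show ?thesis
    by (simp add: card_image d_def g_def)
qed

text \<open>Each residue gets as weight the reciprocal of its orbit's length, so every orbit has
  total weight 1. Since the length depends only on the gcd with m, regrouping the residues by that
  gcd brings in the totients.\<close>

lemma card_mult_orbits:
  assumes m: "m > 0" and cop: "coprime m r"
  shows "real (card (mult_orbits m r)) = (\<Sum>d | d dvd m. real (totient d) / real (ord d r))"
proof -
  define h where "h i = 1 / real (ord (m div gcd i m) r)" for i
  have "(\<Sum>i<m. h i) = (\<Sum>B\<in>mult_orbits m r. \<Sum>i\<in>{i\<in>{..<m}. mult_orbit m r i = B}. h i)"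
    unfolding mult_orbits_def by (rule sum.image_gen) simp
  also have "\<dots> = (\<Sum>B\<in>mult_orbits m r. 1)"
  proof (rule sum.cong)
    fix B assume "B \<in> mult_orbits m r"
    then obtain k where k: "k < m" "B = mult_orbit m r k" by (auto simp: mult_orbits_def)
    have "{i\<in>{..<m}. mult_orbit m r i = B} = B"
      using mult_orbit_subset[OF m, of r k] mult_orbit_eq[OF cop] mult_orbit_self k by blast
    moreover have "h i = 1 / real (card B)" if "mult_orbit m r i = B" for i
      using card_mult_orbit[OF assms, of i] that by (simp add: h_def)
    moreover have "card B > 0"
      using mult_orbit_self[OF k(1), of r] mult_orbit_subset[OF m, of r k] k(2)
      by (metis card_gt_0_iff empty_iff finite_lessThan finite_subset)
    moreover have "(\<Sum>i\<in>{i\<in>{..<m}. mult_orbit m r i = B}. h i) =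
        (\<Sum>i\<in>{i\<in>{..<m}. mult_orbit m r i = B}. 1 / real (card B))"
      using \<open>\<And>i. mult_orbit m r i = B \<Longrightarrow> h i = 1 / real (card B)\<close> by (intro sum.cong) auto
    ultimately show "(\<Sum>i\<in>{i\<in>{..<m}. mult_orbit m r i = B}. h i) = 1"
      by simp
  qed simp
  finally have card: "real (card (mult_orbits m r)) = (\<Sum>i<m. h i)" by simp
  \<comment> \<open>The representative 0 is exchanged for m, which has the same gcd with m, to match
    the range 1..m used in counting by totients.\<close>
  have "(\<Sum>i<m. h i) = (\<Sum>i\<in>{0<..m}. h i)"
  proof -
    have "{..<m} = insert 0 {0<..<m}" "{0<..m} = insert m {0<..<m}" using m by auto
    moreover have "h 0 = h m" by (simp add: h_def)
    ultimately show ?thesis using m by simp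
  qed
  also have "\<dots> = (\<Sum>g\<in>{g. g dvd m}. \<Sum>i\<in>{i\<in>{0<..m}. gcd i m = g}. h i)"
    by (rule sum.group[symmetric]) (use m in auto)
  also have "\<dots> = (\<Sum>g\<in>{g. g dvd m}. real (totient (m div g)) / real (ord (m div g) r))"
  proof (rule sum.cong)
    fix g assume "g \<in> {g. g dvd m}"
    hence "card {i\<in>{0<..m}. gcd i m = g} = totient (m div g)"
      using card_gcd_eq_totient[OF m] by simp
    moreover have "(\<Sum>i\<in>{i\<in>{0<..m}. gcd i m = g}. h i) =
        (\<Sum>i\<in>{i\<in>{0<..m}. gcd i m = g}. 1 / real (ord (m div g) r))"
      by (rule sum.cong) (auto simp: h_def)
    ultimately show "(\<Sum>i\<in>{i\<in>{0<..m}. gcd i m = g}. h i) =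
        real (totient (m div g)) / real (ord (m div g) r)"
      by simp
  qed simp
  \<comment> \<open>The divisors are re-indexed by g = m / d.\<close>
  also have "\<dots> = (\<Sum>d | d dvd m. real (totient d) / real (ord d r))"
    using m by (intro sum.reindex_bij_witness[of _ "(div) m" "(div) m"]) (auto elim: dvdE)
  finally show ?thesis using card by simp
qed

text \<open>With r = -q modulo d one has r^2 = q^2, so the order of q^2 is that of r, halved when
  even. For odd i, r^i = 1 means that d divides q^i + 1; hence lambda is 1 precisely when r has odd
  order, that order being itself an admissible i.\<close>

lemma ord_neg_mult:
  assumes m: "m > 0" and cop: "coprime m q" and d: "d dvd m"
  shows "ord d ((m - 1) * q) = (if lambda_ind d q = 1 then 1 else 2) * ord d (q\<^sup>2)"
proof -
  define r where "r = (m - 1) * q"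
  have "[int r = - int q] (mod int m)"
    using m by (simp add: r_def of_nat_diff cong_iff_dvd_diff algebra_simps)
  hence r: "[int r = - int q] (mod int d)"
    using d by (meson cong_dvd_modulus of_nat_dvd_iff)
  have cop_q: "coprime d q" using cop d by (meson coprime_divisors dvd_refl)
  have cop_r: "coprime d r"
  proof -
    have "coprime m (m - 1)"
      using m coprime_diff_one_right_nat by simp
    hence "coprime m r" using cop by (simp add: r_def)
    thus ?thesis using d by (meson coprime_divisors dvd_refl)
  qed
  have pow_iff: "[r ^ i = 1] (mod d) \<longleftrightarrow> d dvd q ^ i + 1" if "odd i" for i
  proof -
    have "[r ^ i = 1] (mod d) \<longleftrightarrow> [int r ^ i = 1] (mod int d)"
      by (metis cong_int_iff of_nat_1 of_nat_power)
    also have "\<dots> \<longleftrightarrow> [(- int q) ^ i = 1] (mod int d)"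
      using cong_pow[OF r, of i] by (simp add: cong_def)
    also have "\<dots> \<longleftrightarrow> int d dvd (- int q) ^ i - 1"
      by (rule cong_iff_dvd_diff)
    also have "(- int q) ^ i - 1 = - int (q ^ i + 1)"
      using that by (simp add: power_minus_odd)
    finally show ?thesis by (simp only: dvd_minus_iff of_nat_dvd_iff)
  qed
  have "[int (r\<^sup>2) = int (q\<^sup>2)] (mod int d)"
    using cong_pow[OF r, of 2] by simp
  hence "[r\<^sup>2 = q\<^sup>2] (mod d)" by (simp only: cong_int_iff)
  hence "ord d (q\<^sup>2) = ord d (r\<^sup>2)" by (intro ord_cong) (simp_all add: cong_sym_eq)
  hence sq: "ord d (q\<^sup>2) = ord d r div gcd 2 (ord d r)"
    using ord_power[OF cop_r, of 2] by simp
  have lambda: "lambda_ind d q = 1 \<longleftrightarrow> odd (ord d r)"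
  proof
    assume "lambda_ind d q = 1"
    then obtain i where i: "odd i" "d dvd q ^ i + 1"
      by (auto simp: lambda_ind_def split: if_splits)
    hence "ord d r dvd i" using pow_iff ord_divides by blast
    thus "odd (ord d r)" using i by (meson dvd_trans)
  next
    assume odd: "odd (ord d r)"
    hence "d dvd q ^ ord d r + 1" using pow_iff ord[of r d] by blast
    with odd show "lambda_ind d q = 1" by (auto simp: lambda_ind_def)
  qed
  show ?thesis
  proof (cases "odd (ord d r)")
    case True
    hence "gcd 2 (ord d r) = 1"
      by (intro coprime_imp_gcd_eq_1) simp
    thus ?thesis
      using True sq lambda unfolding r_def by simp
  next
    case False
    hence "gcd 2 (ord d r) = 2" and double: "2 * (ord d r div 2) = ord d r"
      by (auto intro: gcd_nat.absorb1)
    hence "2 * ord d (q\<^sup>2) = ord d r"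
      using sq by simp
    thus ?thesis
      using False lambda unfolding r_def by simp
  qed
qed

section \<open>Counting invariant idempotents\<close>

context hermitian_field
begin

text \<open>The exponent \<open>(m - 1) * q\<close> represents \<open>- q\<close> modulo \<open>m\<close>.\<close>

definition neg_fixed :: "nat \<Rightarrow> 'a poly set" where
  "neg_fixed m = {u. degree u < m \<and> [pcompose u (monom 1 ((m - 1) * q)) = u] (mod circ_poly m)}"

text \<open>If u is idempotent then so is \<open>star m u\<close>, which therefore equals its q-th
  power. By \<open>star_frob\<close> the semilinear condition of invariance turns into an F-linear
  one.\<close>

lemma selfdual_idempotents_eq:
  assumes m: "m > 0"
  shows "selfdual_idempotents m = {u \<in> neg_fixed m. [u * u = u] (mod circ_poly m)}"
proof -
  have "[star m u = u] (mod circ_poly m) \<longleftrightarrow> [star m u ^ q = u] (mod circ_poly m)"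
    if u: "[u * u = u] (mod circ_poly m)" for u
  proof -
    have "[star m u * star m u = star m u] (mod circ_poly m)"
      using star_cong[OF u] by (simp add: star_mult)
    hence "[star m u ^ q = star m u] (mod circ_poly m)"
      using q_pos by (rule idempotent_power)
    thus ?thesis by (simp add: cong_def)
  qed
  thus ?thesis by (auto simp: selfdual_idempotents_def neg_fixed_def star_frob)
qed

text \<open>Raising to the power q^2 substitutes X^(q^2) for X. As q^2 = (-q)^2 modulo m, this is
  the substitution of X^(-q) done twice, and u is fixed by each.\<close>

lemma neg_fixed_frob:
  assumes m: "m > 0" and u: "u \<in> neg_fixed m"
  shows "[u ^ q\<^sup>2 = u] (mod circ_poly m)"
proof -
  define r where "r = (m - 1) * q"
  have ur: "[pcompose u (monom 1 r) = u] (mod circ_poly m)"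
    using u by (simp add: neg_fixed_def r_def)
  have "[int r = - int q] (mod int m)"
    using m by (simp add: r_def of_nat_diff cong_iff_dvd_diff algebra_simps)
  hence "[int (r * r) = int (q\<^sup>2)] (mod int m)"
    using cong_mult[of "int r" "- int q" "int m" "int r" "- int q"] by (simp add: power2_eq_square)
  hence "[q\<^sup>2 = r * r] (mod m)"
    by (simp only: cong_int_iff cong_sym_eq)
  hence "[u ^ q\<^sup>2 = pcompose u (monom 1 (r * r))] (mod circ_poly m)"
    unfolding frob_frob_poly by (rule pcompose_cong_exponent)
  also have "pcompose u (monom 1 (r * r)) = pcompose (pcompose u (monom 1 r)) (monom 1 r)"
    by (simp add: pcompose_pcompose_monom)
  also have "[\<dots> = pcompose u (monom 1 r)] (mod circ_poly m)"
    using ur by (rule pcompose_cong_circ_poly)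
  also note ur
  finally show ?thesis .
qed

lemma neg_fixed_iff:
  assumes m: "m > 0" and cop: "coprime m ((m - 1) * q)"
  shows "u \<in> neg_fixed m \<longleftrightarrow>
    degree u < m \<and> (\<forall>i<m. coeff u ((i * ((m - 1) * q)) mod m) = coeff u i)"
proof (cases "degree u < m")
  case True
  define r where "r = (m - 1) * q"
  define s where "s i = (i * r) mod m" for i
  have "inj_on s {..<m}"
  proof (rule inj_onI)
    fix i j assume ij: "i \<in> {..<m}" "j \<in> {..<m}" "s i = s j"
    hence "[i * r = j * r] (mod m)" by (simp add: s_def cong_def)
    hence "[i = j] (mod m)"
      using cong_mult_rcancel_nat[of r m i j] cop by (simp add: r_def coprime_commute)
    thus "i = j" using ij by (simp add: cong_def)
  qed
  moreover have "s ` {..<m} \<subseteq> {..<m}" using m by (auto simp: s_def)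
  ultimately have surj: "s ` {..<m} = {..<m}" and inj: "inj_on s {..<m}"
    using endo_inj_surj[of "{..<m}" s] by auto
  define v where "v = pcompose u (monom 1 r) mod circ_poly m"
  have u_eq: "u = (\<Sum>i<m. monom (coeff u i) i)"
    using True by (rule poly_eq_sum_monom)
  have "pcompose u (monom 1 r) = (\<Sum>i<m. monom (coeff u i) (i * r))"
    by (subst u_eq) (simp add: pcompose_sum pcompose_monom_monom)
  \<comment> \<open>The substitution moves the coefficient at j to position \<open>s j\<close>;
    injectivity of s excludes collisions.\<close>
  hence coeff_v: "coeff v (s j) = coeff u j" if "j < m" for j
  proof -
    have "coeff v (s j) = (\<Sum>i<m. if s i = s j then coeff u i else 0)"
      unfolding v_def \<open>pcompose u (monom 1 r) = _\<close>
      using m by (subst coeff_sum_monom_mod) (auto simp: s_def)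
    also have "\<dots> = (\<Sum>i<m. if i = j then coeff u i else 0)"
      using inj that by (intro sum.cong) (auto simp: inj_on_def)
    also have "\<dots> = coeff u j" using that by simp
    finally show ?thesis .
  qed
  have deg_v: "degree v < m" using m by (simp add: v_def degree_mod_circ_poly)
  have "u \<in> neg_fixed m \<longleftrightarrow> v = u"
    using True mod_circ_poly_eq_iff[OF m, of u] by (auto simp: neg_fixed_def v_def r_def cong_def)
  also have "\<dots> \<longleftrightarrow> (\<forall>k<m. coeff v k = coeff u k)"
    using True deg_v by (auto simp: poly_eq_iff) (metis coeff_eq_0 less_le_trans not_less)
  \<comment> \<open>Since s is a permutation, the coefficients may be compared at the positions
    \<open>s j\<close> only.\<close>
  also have "\<dots> \<longleftrightarrow> (\<forall>k\<in>s ` {..<m}. coeff v k = coeff u k)"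
    unfolding surj by auto
  also have "\<dots> \<longleftrightarrow> (\<forall>j<m. coeff u (s j) = coeff u j)"
    using coeff_v by auto
  finally show ?thesis using True by (simp add: s_def r_def)
qed (simp add: neg_fixed_def)

text \<open>By \<open>neg_fixed_iff\<close> the coefficients are constant along the orbits of
  multiplication by -q, and otherwise free: an element amounts to an arbitrary function from the
  orbits to the field.\<close>

lemma card_neg_fixed:
  assumes m: "m > 0" and cop: "coprime m ((m - 1) * q)"
  shows "card (neg_fixed m) = (q\<^sup>2) ^ card (mult_orbits m ((m - 1) * q))"
proof -
  define r where "r = (m - 1) * q"
  define B where "B = mult_orbits m r"
  define orb where "orb = mult_orbit m r"
  define \<phi> where "\<phi> g = (\<Sum>i<m. monom (g (orb i) :: 'a) i)" for g
  \<comment> \<open>\<open>inv_into\<close> picks a representative of each orbit;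
    \<open>restrict\<close> makes the function extensional, as inverting \<phi> on the function
    space requires.\<close>
  define \<psi> where "\<psi> u = restrict (\<lambda>b. coeff (u :: 'a poly) (inv_into {..<m} orb b)) B" for u
  have cop_r: "coprime m r" using cop by (simp add: r_def)
  have B: "B = orb ` {..<m}" by (simp add: B_def orb_def mult_orbits_def)
  have orb_step: "orb ((i * r) mod m) = orb i" for i
    unfolding orb_def
    by (rule mult_orbit_eq[OF cop_r]) (auto simp: mult_orbit_def intro!: image_eqI[of _ _ 1])
  have coeff_\<phi>: "coeff (\<phi> g) i = (if i < m then g (orb i) else 0)" for g i
    by (simp add: \<phi>_def coeff_sum)
  have deg_\<phi>: "degree (\<phi> g) < m" for g
    using m by (intro degree_lessI) (auto simp: coeff_\<phi>)
  have const: "coeff u j = coeff u i" if u: "u \<in> neg_fixed m" and ij: "i < m" "j \<in> orb i" for u i j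
  proof -
    obtain t where t: "j = (i * r ^ t) mod m"
      using ij by (auto simp: orb_def mult_orbit_def)
    have "coeff u ((i * r ^ t) mod m) = coeff u i" for t
    proof (induction t)
      case (Suc t)
      have "coeff u ((((i * r ^ t) mod m) * r) mod m) = coeff u ((i * r ^ t) mod m)"
        using u m neg_fixed_iff[OF m cop] by (simp add: r_def)
      moreover have "(((i * r ^ t) mod m) * r) mod m = (i * r ^ Suc t) mod m"
        by (simp only: mod_mult_left_eq power_Suc2 mult.assoc)
      ultimately show ?case using Suc.IH by simp
    qed (use ij in simp)
    thus ?thesis by (simp add: t)
  qed
  have inv: "inv_into {..<m} orb (orb i) < m" "orb (inv_into {..<m} orb (orb i)) = orb i"
    if "i < m" for i
    using that inv_into_into[of "orb i" orb "{..<m}"] f_inv_into_f[of "orb i" orb "{..<m}"] by auto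
  have "bij_betw \<phi> (B \<rightarrow>\<^sub>E UNIV) (neg_fixed m)"
  proof (rule bij_betw_byWitness[of _ \<psi>])
    show "\<forall>g\<in>B \<rightarrow>\<^sub>E UNIV. \<psi> (\<phi> g) = g"
    proof
      fix g :: "nat set \<Rightarrow> 'a" assume g: "g \<in> B \<rightarrow>\<^sub>E UNIV"
      show "\<psi> (\<phi> g) = g"
      proof
        fix b show "\<psi> (\<phi> g) b = g b"
        proof (cases "b \<in> B")
          case True
          then obtain i where "i < m" "b = orb i" by (auto simp: B)
          thus ?thesis using True inv by (simp add: \<psi>_def coeff_\<phi>)
        next
          case False
          thus ?thesis using g by (simp add: \<psi>_def PiE_def extensional_def)
        qed
      qed
    qed
    show "\<forall>u\<in>neg_fixed m. \<phi> (\<psi> u) = u"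
    proof
      fix u assume u: "u \<in> neg_fixed m"
      show "\<phi> (\<psi> u) = u"
      proof (rule poly_eqI)
        fix i show "coeff (\<phi> (\<psi> u)) i = coeff u i"
        proof (cases "i < m")
          case True
          have "i \<in> orb (inv_into {..<m} orb (orb i))"
            using True inv[OF True] mult_orbit_self[OF True] by (simp add: orb_def)
          hence "coeff u i = coeff u (inv_into {..<m} orb (orb i))"
            using const[OF u] inv[OF True] by blast
          thus ?thesis using True by (simp add: coeff_\<phi> \<psi>_def B)
        next
          case False
          thus ?thesis using u by (simp add: coeff_\<phi> neg_fixed_def coeff_eq_0)
        qed
      qed
    qed
    show "\<phi> ` (B \<rightarrow>\<^sub>E UNIV) \<subseteq> neg_fixed m"
      using m orb_step deg_\<phi>
      by (auto simp: neg_fixed_iff[OF m cop, folded r_def] coeff_\<phi>)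
    show "\<psi> ` neg_fixed m \<subseteq> B \<rightarrow>\<^sub>E UNIV"
      by (auto simp: \<psi>_def)
  qed
  hence "card (neg_fixed m) = card (B \<rightarrow>\<^sub>E (UNIV :: 'a set))"
    by (metis bij_betw_same_card)
  also have "\<dots> = (q\<^sup>2) ^ card B"
    by (subst card_PiE) (auto simp: B card_field)
  finally show ?thesis by (simp add: B_def r_def)
qed

text \<open>\<open>card_idempotents\<close> is applied with e the identity, so that e U is all of
  \<open>neg_fixed m\<close>. The same M governs both counts, and the known size of
  \<open>neg_fixed m\<close> determines it.\<close>

lemma card_selfdual_idempotents:
  assumes m: "m > 0" and cop: "coprime m q"
  shows "card (selfdual_idempotents m) = 2 ^ card (mult_orbits m ((m - 1) * q))"
proof -
  let ?P = "circ_poly m :: 'a poly" and ?r = "(m - 1) * q"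
  have cop_r: "coprime m ?r"
    using m cop coprime_diff_one_right_nat by simp
  define e where "e = 1 mod ?P"
  have e1: "[e = 1] (mod ?P)" by (simp add: e_def)
  have eu: "[e * u = u] (mod ?P)" for u
    using cong_scalar_right[OF e1, of u] by simp
  have neg_fixedI: "u mod ?P \<in> neg_fixed m"
    if "[pcompose u (monom 1 ?r) = u] (mod ?P)" for u
  proof -
    have "[pcompose (u mod ?P) (monom 1 ?r) = pcompose u (monom 1 ?r)] (mod ?P)"
      by (rule pcompose_cong_circ_poly) simp
    with that show ?thesis
      using m by (simp add: neg_fixed_def degree_mod_circ_poly cong_def)
  qed
  have fixed: "[pcompose u (monom 1 ?r) = u] (mod ?P)" "u mod ?P = u" if "u \<in> neg_fixed m" for u
    using that m by (auto simp: neg_fixed_def mod_circ_poly_eq_iff)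
  have "\<exists>M. card {u \<in> neg_fixed m. [e * u = u] (mod ?P)} = (q\<^sup>2) ^ M \<and>
    card {u \<in> neg_fixed m. [e * u = u] (mod ?P) \<and> [u * u = u] (mod ?P)} = 2 ^ M"
  proof (rule card_idempotents)
    show "finite (neg_fixed m)"
      by (rule finite_subset[OF _ finite_degree_less[of m]]) (auto simp: neg_fixed_def)
    show "u + v \<in> neg_fixed m" if "u \<in> neg_fixed m" "v \<in> neg_fixed m" for u v
      using that cong_add[OF fixed(1) fixed(1), of u v]
      by (auto simp: neg_fixed_def pcompose_add intro: degree_add_less)
    show "smult c u \<in> neg_fixed m" if "u \<in> neg_fixed m" for c u
      using that cong_scalar_left[OF fixed(1)[OF that], of "[:c:]"]
      by (auto simp: neg_fixed_def pcompose_smult intro: le_less_trans[OF degree_smult_le])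
    show "(u * v) mod ?P \<in> neg_fixed m" if "u \<in> neg_fixed m" "v \<in> neg_fixed m" for u v
      using cong_mult[OF fixed(1) fixed(1), OF that] by (intro neg_fixedI) (simp add: pcompose_mult)
    show "e \<in> neg_fixed m"
      unfolding e_def by (rule neg_fixedI) (simp add: pcompose_1)
  qed (use m eu fixed neg_fixed_frob in auto)
  then obtain M where M: "card (neg_fixed m) = (q\<^sup>2) ^ M" "card (selfdual_idempotents m) = 2 ^ M"
    using eu m by (auto simp: selfdual_idempotents_eq)
  have "M = card (mult_orbits m ?r)"
    using M(1) card_neg_fixed[OF m cop_r] q_gt_1 power_inject_exp[of "q\<^sup>2" M]
    by (metis one_less_power pos2)
  with M show ?thesis by simp
qed

end

section \<open>Codes and idempotents\<close>

text \<open>Reducing first admits every polynomial as argument, so that a code can be pulled back to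
  an ideal of F[X] containing X^m - 1.\<close>

definition poly_to_vec :: "nat \<Rightarrow> 'a :: field poly \<Rightarrow> 'a vec" where
  "poly_to_vec m f = vec m (coeff (f mod circ_poly m))"

lemma poly_to_vec_carrier [simp]: "poly_to_vec m f \<in> carrier_vec m"
  by (simp add: poly_to_vec_def)

lemma poly_to_vec_eq_iff:
  assumes m: "m > 0"
  shows "poly_to_vec m f = poly_to_vec m g \<longleftrightarrow> [f = g] (mod circ_poly m)"
proof
  assume eq: "poly_to_vec m f = poly_to_vec m g"
  have "coeff (f mod circ_poly m) i = coeff (g mod circ_poly m) i" for i
  proof (cases "i < m")
    case True
    thus ?thesis using arg_cong[OF eq, of "\<lambda>v. v $ i"] by (simp add: poly_to_vec_def)
  next
    case False
    thus ?thesis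
      using degree_mod_circ_poly[OF m, of f] degree_mod_circ_poly[OF m, of g]
      by (simp add: coeff_eq_0)
  qed
  thus "[f = g] (mod circ_poly m)" by (simp add: cong_def poly_eq_iff)
qed (simp add: poly_to_vec_def cong_def)

lemma poly_to_vec_surj:
  assumes "v \<in> carrier_vec m"
  obtains f where "v = poly_to_vec m f"
proof (cases "m = 0")
  case True
  thus ?thesis using assms by (intro that[of 0]) (auto simp: poly_to_vec_def)
next
  case False
  show ?thesis
  proof (rule that[of "\<Sum>i<m. monom (v $ i) i"])
    have "coeff ((\<Sum>i<m. monom (v $ i) i) mod circ_poly m) k = v $ k" if "k < m" for k
      using that False by (subst coeff_sum_monom_mod) (auto cong: if_cong)
    thus "v = poly_to_vec m (\<Sum>i<m. monom (v $ i) i)"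
      using assms by (intro eq_vecI) (auto simp: poly_to_vec_def)
  qed
qed

lemma poly_to_vec_add: "poly_to_vec m (f + g) = poly_to_vec m f + poly_to_vec m g"
  by (rule eq_vecI) (simp_all add: poly_to_vec_def poly_mod_add_left)

lemma poly_to_vec_0: "poly_to_vec m 0 = 0\<^sub>v m"
  by (rule eq_vecI) (simp_all add: poly_to_vec_def)

lemma poly_to_vec_mult:
  assumes m: "m > 0"
  shows "poly_to_vec m (f * g) = poly_to_vec m f \<otimes>\<^bsub>cyclic_algebra m\<^esub> poly_to_vec m g"
proof -
  define f' g' where "f' = f mod circ_poly m" and "g' = g mod circ_poly m"
  have sums: "f' = (\<Sum>i<m. monom (coeff f' i) i)" "g' = (\<Sum>i<m. monom (coeff g' i) i)"
    using m by (auto simp: f'_def g'_def intro: poly_eq_sum_monom degree_mod_circ_poly)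
  have "f' * g' = (\<Sum>i<m. monom (coeff f' i) i) * (\<Sum>j<m. monom (coeff g' j) j)"
    by (rule arg_cong2[OF sums])
  also have "\<dots> = (\<Sum>(i, j)\<in>{..<m} \<times> {..<m}. monom (coeff f' i * coeff g' j) (i + j))"
    by (simp add: sum_product sum.cartesian_product mult_monom)
  \<comment> \<open>A single sum over pairs is the form in which \<open>coeff_sum_monom_mod\<close>
    applies.\<close>
  also have "\<dots> = (\<Sum>z\<in>{..<m} \<times> {..<m}. monom (coeff f' (fst z) * coeff g' (snd z)) (fst z + snd z))"
    by (simp add: case_prod_unfold)
  finally have prod: "f' * g' = \<dots>" .
  have "coeff ((f * g) mod circ_poly m) k =
      (\<Sum>i<m. \<Sum>j<m. if (i + j) mod m = k then coeff f' i * coeff g' j else 0)" if "k < m" for k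
  proof -
    have "(f * g) mod circ_poly m = (f' * g') mod circ_poly m"
      by (simp add: f'_def g'_def mod_mult_eq)
    thus ?thesis
      unfolding prod using that m
      by (simp add: coeff_sum_monom_mod sum.cartesian_product case_prod_unfold)
  qed
  thus ?thesis
    by (intro eq_vecI) (auto simp: cyclic_algebra_def poly_to_vec_def f'_def g'_def intro!: sum.cong)
qed

section \<open>The Hermitian dual in terms of the involution\<close>

context hermitian_field
begin

text \<open>In f times \<open>star m g\<close>, the terms at i and j meet in X^(i - j), so the
  constant coefficient collects exactly the pairs with i = j.\<close>

lemma hermitian_inner_poly_to_vec:
  assumes m: "m > 0"
  shows "hermitian_inner q m (poly_to_vec m f) (poly_to_vec m g) =
    coeff ((f * star m g) mod circ_poly m) 0"
proof -
  define f' g' where "f' = f mod circ_poly m" and "g' = g mod circ_poly m"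
  have "[f' = f] (mod circ_poly m)" "[star m g' = star m g] (mod circ_poly m)"
    by (auto simp: f'_def g'_def intro: star_cong)
  hence "[f * star m g = f' * star m g'] (mod circ_poly m)"
    by (intro cong_mult) (auto intro: cong_sym)
  moreover have "f' * star m g' = (\<Sum>z\<in>{..<m} \<times> {..<m}.
      monom (coeff f' (fst z) * coeff g' (snd z) ^ q) (fst z + snd z * (m - 1)))"
  proof -
    have f: "f' = (\<Sum>i<m. monom (coeff f' i) i)" and g: "g' = (\<Sum>i<m. monom (coeff g' i) i)"
      using m by (auto simp: f'_def g'_def intro: poly_eq_sum_monom degree_mod_circ_poly)
    have "star m g' = (\<Sum>j<m. monom (coeff g' j ^ q) (j * (m - 1)))"
      by (subst g) (simp add: star_sum star_monom)
    hence "f' * star m g' = (\<Sum>i<m. monom (coeff f' i) i) * (\<Sum>j<m. monom (coeff g' j ^ q) (j * (m - 1)))"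
      by (rule arg_cong2[OF f])
    thus ?thesis by (simp add: sum_product sum.cartesian_product mult_monom case_prod_unfold)
  qed
  ultimately have "coeff ((f * star m g) mod circ_poly m) 0 =
      (\<Sum>z\<in>{..<m} \<times> {..<m}. if (fst z + snd z * (m - 1)) mod m = 0
        then coeff f' (fst z) * coeff g' (snd z) ^ q else 0)"
    unfolding cong_def using m by (simp only: coeff_sum_monom_mod)
  also have "\<dots> = (\<Sum>i<m. \<Sum>j<m. if (i + j * (m - 1)) mod m = 0 then coeff f' i * coeff g' j ^ q else 0)"
    by (simp add: sum.cartesian_product case_prod_unfold)
  also have "\<dots> = (\<Sum>i<m. \<Sum>j<m. if i = j then coeff f' i * coeff g' j ^ q else 0)"
  proof (intro sum.cong refl if_cong)
    fix i j assume ij: "i \<in> {..<m}" "j \<in> {..<m}"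
    \<comment> \<open>Adding j on both sides replaces the exponent \<open>m - 1\<close> by a
      multiple of m.\<close>
    have "(i + j * (m - 1)) mod m = 0 \<longleftrightarrow> [i + j * (m - 1) + j = 0 + j] (mod m)"
      unfolding cong_add_rcancel_nat by (simp add: cong_def)
    also have "i + j * (m - 1) + j = i + j * m"
      using m by (cases m) auto
    also have "[i + j * m = 0 + j] (mod m) \<longleftrightarrow> i = j"
      using ij by (simp add: cong_def)
    finally show "(i + j * (m - 1)) mod m = 0 \<longleftrightarrow> i = j" .
  qed
  also have "\<dots> = hermitian_inner q m (poly_to_vec m f) (poly_to_vec m g)"
    by (simp add: hermitian_inner_def poly_to_vec_def f'_def g'_def)
  finally show ?thesis ..
qed

text \<open>Taking h = X^(m - k) shifts the coefficient of z at k into the constant position, so all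
  coefficients of the remainder vanish.\<close>

lemma cong_0_if_const_coeffs:
  assumes m: "m > 0" and zero: "\<And>h. coeff ((h * z) mod circ_poly m) 0 = 0"
  shows "[z = 0] (mod (circ_poly m :: 'a poly))"
proof -
  define z' where "z' = z mod circ_poly m"
  have deg: "degree z' < m" using m by (simp add: z'_def degree_mod_circ_poly)
  have "coeff z' k = 0" if k: "k < m" for k
  proof -
    have "0 = coeff ((monom 1 (m - k) * z') mod circ_poly m) 0"
      using zero[of "monom 1 (m - k)"] by (simp add: z'_def mod_mult_right_eq)
    also have "monom 1 (m - k) * z' = (\<Sum>i<m. monom (coeff z' i) (m - k + i))"
      by (subst poly_eq_sum_monom[OF deg]) (simp add: sum_distrib_left mult_monom)
    also have "coeff (\<dots> mod circ_poly m) 0 = (\<Sum>i<m. if (m - k + i) mod m = 0 then coeff z' i else 0)"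
      using m by (rule coeff_sum_monom_mod) (rule m)
    also have "\<dots> = (\<Sum>i<m. if i = k then coeff z' i else 0)"
    proof (intro sum.cong refl if_cong)
      fix i assume i: "i \<in> {..<m}"
      have "(m - k + i) mod m = 0 \<longleftrightarrow> [m - k + i + k = 0 + k] (mod m)"
        unfolding cong_add_rcancel_nat by (simp add: cong_def)
      also have "m - k + i + k = i + m" using k by simp
      also have "[i + m = 0 + k] (mod m) \<longleftrightarrow> i = k"
        using i k by (simp add: cong_def)
      finally show "(m - k + i) mod m = 0 \<longleftrightarrow> i = k" .
    qed
    also have "\<dots> = coeff z' k" using k by simp
    finally show ?thesis ..
  qed
  hence "z' = 0"
    using deg by (intro poly_eqI) (metis coeff_0 coeff_eq_0 le_less_trans not_less)
  thus ?thesis by (simp add: z'_def cong_def)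
qed

text \<open>Orthogonality concerns only constant coefficients. As C is an ideal, c may be replaced
  by every multiple h c, and \<open>cong_0_if_const_coeffs\<close> then kills the whole
  product.\<close>

lemma poly_to_vec_in_hermitian_dual:
  assumes m: "m > 0" and C: "cyclic_code m C"
  shows "poly_to_vec m y \<in> hermitian_dual q m C \<longleftrightarrow>
    (\<forall>c. poly_to_vec m c \<in> C \<longrightarrow> [c * star m y = 0] (mod circ_poly m))"
proof -
  interpret ideal C "cyclic_algebra m :: 'a vec ring"
    using C by (simp add: cyclic_code_def)
  have carr: "carrier (cyclic_algebra m :: 'a vec ring) = carrier_vec m"
    by (simp add: cyclic_algebra_def)
  show ?thesis
  proof
    assume dual: "poly_to_vec m y \<in> hermitian_dual q m C"
    show "\<forall>c. poly_to_vec m c \<in> C \<longrightarrow> [c * star m y = 0] (mod circ_poly m)"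
    proof (intro allI impI)
      fix c assume c: "poly_to_vec m c \<in> C"
      show "[c * star m y = 0] (mod circ_poly m)"
      proof (rule cong_0_if_const_coeffs[OF m])
        fix h
        have "poly_to_vec m (h * c) \<in> C"
          using I_l_closed[OF c] carr by (simp add: poly_to_vec_mult[OF m])
        hence "hermitian_inner q m (poly_to_vec m (h * c)) (poly_to_vec m y) = 0"
          using dual by (simp add: hermitian_dual_def)
        thus "coeff ((h * (c * star m y)) mod circ_poly m) 0 = 0"
          by (simp add: hermitian_inner_poly_to_vec[OF m] mult.assoc)
      qed
    qed
  next
    assume *: "\<forall>c. poly_to_vec m c \<in> C \<longrightarrow> [c * star m y = 0] (mod circ_poly m)"
    have "hermitian_inner q m c (poly_to_vec m y) = 0" if c: "c \<in> C" for c
    proof -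
      obtain f where f: "c = poly_to_vec m f"
        using poly_to_vec_surj[of c m] a_subset c carr by blast
      with * c have "(f * star m y) mod circ_poly m = 0" by (auto simp: cong_def)
      thus ?thesis by (simp add: f hermitian_inner_poly_to_vec[OF m])
    qed
    thus "poly_to_vec m y \<in> hermitian_dual q m C" by (simp add: hermitian_dual_def)
  qed
qed

section \<open>Invariant idempotents as generators of complementary dual codes\<close>

definition idempotent_code :: "nat \<Rightarrow> 'a poly \<Rightarrow> 'a vec set" where
  "idempotent_code m e = PIdl\<^bsub>cyclic_algebra m\<^esub> (poly_to_vec m e)"

lemma poly_to_vec_in_idempotent_code:
  assumes m: "m > 0" and e: "[e * e = e] (mod circ_poly m)"
  shows "poly_to_vec m f \<in> idempotent_code m e \<longleftrightarrow> [e * f = f] (mod circ_poly m)"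
proof
  assume "poly_to_vec m f \<in> idempotent_code m e"
  then obtain x where x: "x \<in> carrier_vec m"
      "poly_to_vec m f = x \<otimes>\<^bsub>cyclic_algebra m\<^esub> poly_to_vec m e"
    by (auto simp: idempotent_code_def cgenideal_def cyclic_algebra_def)
  obtain h where "x = poly_to_vec m h" using poly_to_vec_surj[OF x(1)] .
  hence f: "[f = h * e] (mod circ_poly m)"
    using x(2) by (simp flip: poly_to_vec_mult[OF m] add: poly_to_vec_eq_iff[OF m])
  have "[e * f = e * (h * e)] (mod circ_poly m)" using f by (rule cong_scalar_left)
  also have "e * (h * e) = h * (e * e)" by (simp add: mult_ac)
  also have "[h * (e * e) = h * e] (mod circ_poly m)" using e by (rule cong_scalar_left)
  also have "[h * e = f] (mod circ_poly m)" using f by (rule cong_sym)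
  finally show "[e * f = f] (mod circ_poly m)" .
next
  assume "[e * f = f] (mod circ_poly m)"
  hence "poly_to_vec m f = poly_to_vec m f \<otimes>\<^bsub>cyclic_algebra m\<^esub> poly_to_vec m e"
    by (simp flip: poly_to_vec_mult[OF m] add: poly_to_vec_eq_iff[OF m] mult.commute cong_sym_eq)
  moreover have "poly_to_vec m f \<in> carrier (cyclic_algebra m)"
    by (simp add: cyclic_algebra_def)
  ultimately show "poly_to_vec m f \<in> idempotent_code m e"
    unfolding idempotent_code_def cgenideal_def by blast
qed

lemma cyclic_code_idempotent_code: "cyclic_code m (idempotent_code m e)"
  unfolding cyclic_code_def idempotent_code_def
  by (rule cring.cgenideal_ideal[OF cring_cyclic_algebra]) (simp add: cyclic_algebra_def)

text \<open>The idempotent e is itself a codeword, so f in the dual satisfies e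
  \<open>star m f\<close> = 0. Applying the involution gives e f = 0, whereas f in the code
  satisfies e f = f.\<close>

lemma idempotent_code_hcd:
  assumes m: "m > 0" and e: "e \<in> selfdual_idempotents m"
  shows "idempotent_code m e \<in> hcd_cyclic_codes q m"
proof -
  have ee: "[e * e = e] (mod circ_poly m)" and se: "[star m e = e] (mod circ_poly m)"
    using e by (auto simp: selfdual_idempotents_def)
  note mem = poly_to_vec_in_idempotent_code[OF m ee]
  note dual = poly_to_vec_in_hermitian_dual[OF m cyclic_code_idempotent_code[of m e]]
  have "x = 0\<^sub>v m" if x: "x \<in> idempotent_code m e" "x \<in> hermitian_dual q m (idempotent_code m e)" for x
  proof -
    have "x \<in> carrier_vec m" using x(2) by (simp add: hermitian_dual_def)
    then obtain f where f: "x = poly_to_vec m f" by (rule poly_to_vec_surj)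
    have ef: "[e * f = f] (mod circ_poly m)" using x(1) mem f by simp
    have "\<forall>c. poly_to_vec m c \<in> idempotent_code m e \<longrightarrow> [c * star m f = 0] (mod circ_poly m)"
      using x(2) dual[of f] unfolding f by simp
    hence "[e * star m f = 0] (mod circ_poly m)" using ee mem[of e] by simp
    from star_cong[OF this] have "[star m e * star m (star m f) = 0] (mod circ_poly m)"
      by (simp add: star_mult)
    from cong_trans[OF cong_sym[OF cong_mult[OF se star_star[OF m]]] this]
    have "[f = 0] (mod circ_poly m)"
      by (rule cong_trans[OF cong_sym[OF ef]])
    thus ?thesis using f poly_to_vec_eq_iff[OF m, of f 0] by (simp add: poly_to_vec_0)
  qed
  moreover have "0\<^sub>v m \<in> idempotent_code m e"
    using mem[of 0] by (simp add: poly_to_vec_0)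
  moreover have "0\<^sub>v m \<in> hermitian_dual q m (idempotent_code m e)"
    using dual[of 0] by (simp add: poly_to_vec_0)
  ultimately have "idempotent_code m e \<inter> hermitian_dual q m (idempotent_code m e) = {0\<^sub>v m}"
    by blast
  thus ?thesis
    using cyclic_code_idempotent_code by (simp add: hcd_cyclic_codes_def hermitian_complementary_dual_def)
qed

lemma hcd_cyclic_code_idempotent:
  assumes m: "m > 0" and C: "C \<in> hcd_cyclic_codes q m"
  obtains e where "e \<in> selfdual_idempotents m" "C = idempotent_code m e"
proof -
  let ?P = "circ_poly m :: 'a poly"
  have cyc: "cyclic_code m C" and hcd: "C \<inter> hermitian_dual q m C = {0\<^sub>v m}"
    using C by (auto simp: hcd_cyclic_codes_def hermitian_complementary_dual_def)
  interpret ideal C "cyclic_algebra m :: 'a vec ring"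
    using cyc by (simp add: cyclic_code_def)
  have R: "carrier (cyclic_algebra m :: 'a vec ring) = carrier_vec m"
      "x \<oplus>\<^bsub>cyclic_algebra m\<^esub> y = x + y" for x y :: "'a vec"
    by (simp_all add: cyclic_algebra_def)
  define I where "I = {f. poly_to_vec m f \<in> C}"
  have I_add: "f + g \<in> I" if "f \<in> I" "g \<in> I" for f g
    using additive_subgroup.a_closed[OF is_additive_subgroup, of "poly_to_vec m f" "poly_to_vec m g"] that
    by (simp add: I_def poly_to_vec_add R)
  have I_mult: "f * g \<in> I" if "f \<in> I" for f g
    using I_r_closed[of "poly_to_vec m f" "poly_to_vec m g"] that
    by (simp add: I_def poly_to_vec_mult[OF m] R)
  have I_cong: "g \<in> I" if "f \<in> I" "[f = g] (mod ?P)" for f g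
    using that poly_to_vec_eq_iff[OF m, of f g] by (simp add: I_def)
  have zero_C: "poly_to_vec m 0 \<in> C"
    using hcd by (auto simp: poly_to_vec_0)
  have P_I: "?P \<in> I"
    by (rule I_cong[of 0]) (use zero_C in \<open>auto simp: I_def cong_def\<close>)
  have dual: "poly_to_vec m y \<in> hermitian_dual q m C \<longleftrightarrow> (\<forall>c\<in>I. [c * star m y = 0] (mod ?P))" for y
    using poly_to_vec_in_hermitian_dual[OF m cyc] by (simp add: I_def)
  \<comment> \<open>Trivial intersection with the dual, restated for the ideal I of
    polynomials.\<close>
  have nondeg: "[x = 0] (mod ?P)" if "x \<in> I" "\<forall>c\<in>I. [c * star m x = 0] (mod ?P)" for x
    using that hcd dual[of x] poly_to_vec_eq_iff[OF m, of x 0] by (auto simp: I_def poly_to_vec_0)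
  \<comment> \<open>For d in I, d times \<open>star m x\<close> lies in I. Its image under the
    involution contains x as a factor and is thus annihilated by I, so \<open>nondeg\<close> makes
    the product zero. As d was arbitrary, \<open>nondeg\<close> applies to x as well.\<close>
  have annihilator: "[x = 0] (mod ?P)" if x: "x \<in> I" "\<forall>c\<in>I. [x * c = 0] (mod ?P)" for x
  proof (rule nondeg[OF x(1)], rule ballI)
    fix d assume d: "d \<in> I"
    show "[d * star m x = 0] (mod ?P)"
    proof (rule nondeg)
      show "d * star m x \<in> I" using d by (rule I_mult)
      show "\<forall>c\<in>I. [c * star m (d * star m x) = 0] (mod ?P)"
      proof
        fix c assume c: "c \<in> I"
        have "c * star m (d * star m x) = (c * star m d) * star m (star m x)"
          by (simp add: star_mult mult_ac)
        also have "[\<dots> = (c * star m d) * x] (mod ?P)"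
          using star_star[OF m] by (rule cong_scalar_left)
        also have "(c * star m d) * x = (x * c) * star m d"
          by (simp add: mult_ac)
        also have "[\<dots> = 0 * star m d] (mod ?P)"
          using x(2) c by (intro cong_scalar_right) blast
        finally show "[c * star m (d * star m x) = 0] (mod ?P)" by simp
      qed
    qed
  qed
  obtain g where g: "g \<in> I" "g \<noteq> 0" and g_dvd: "\<And>f. f \<in> I \<Longrightarrow> g dvd f"
    by (rule poly_ideal_principal[of I ?P]) (use I_add I_mult P_I m in auto)
  obtain h where h: "?P = g * h" using g_dvd[OF P_I] by (auto elim: dvdE)
  \<comment> \<open>The generator d of the ideal spanned by g and h is their gcd; the aim is to show
    that it is a unit.\<close>
  define K where "K = {f. \<exists>a b. f = a * g + b * h}"
  have gK: "g \<in> K" and hK: "h \<in> K"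
    by (auto simp: K_def intro: exI[of _ 0] exI[of _ 1])
  obtain d where d: "d \<in> K" "d \<noteq> 0" and d_dvd: "\<And>f. f \<in> K \<Longrightarrow> d dvd f"
  proof (rule poly_ideal_principal[of K g])
    fix f1 f2 assume "f1 \<in> K" "f2 \<in> K"
    then obtain a1 b1 a2 b2 where "f1 = a1 * g + b1 * h" "f2 = a2 * g + b2 * h"
      by (auto simp: K_def)
    hence "f1 + f2 = (a1 + a2) * g + (b1 + b2) * h" by (simp add: algebra_simps)
    thus "f1 + f2 \<in> K" by (auto simp: K_def)
  next
    fix f1 f2 assume "f1 \<in> K"
    then obtain a b where "f1 = a * g + b * h" by (auto simp: K_def)
    hence "f1 * f2 = (a * f2) * g + (b * f2) * h" by (simp add: algebra_simps)
    thus "f1 * f2 \<in> K" by (auto simp: K_def)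
  qed (use gK g in auto)
  obtain g' h' where g': "g = d * g'" and h': "h = d * h'"
    using d_dvd[OF gK] d_dvd[OF hK] by (auto elim!: dvdE)
  \<comment> \<open>Every c in I is a multiple of g, hence of d. This factor d completes h' to h, so
    g h' c is a multiple of g h = P.\<close>
  have "[g * h' = 0] (mod ?P)"
  proof (rule annihilator)
    show "g * h' \<in> I" using g(1) by (rule I_mult)
    show "\<forall>c\<in>I. [g * h' * c = 0] (mod ?P)"
    proof
      fix c assume "c \<in> I"
      then obtain c' where "c = g * c'" using g_dvd by (auto elim: dvdE)
      hence "g * h' * c = ?P * (g' * c')" by (simp add: h h' g' mult_ac)
      thus "[g * h' * c = 0] (mod ?P)" by (simp add: cong_0_iff)
    qed
  qed
  then obtain k where "g * h' = ?P * k" by (auto simp: cong_0_iff elim: dvdE)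
  \<comment> \<open>P = g d h' divides g h', and cancelling g h' exhibits an inverse of d.\<close>
  hence "(g * h') * 1 = (g * h') * (d * k)" by (simp add: h h' mult_ac)
  moreover have "?P \<noteq> 0" using m by simp
  hence "g * h' \<noteq> 0" by (auto simp: h h')
  ultimately have "1 = d * k" by (metis mult_left_cancel)
  moreover obtain a b where "d = a * g + b * h" using d(1) by (auto simp: K_def)
  ultimately have bezout: "1 = k * a * g + k * b * h" by (simp add: algebra_simps)
  \<comment> \<open>The Bezout summand divisible by g: 1 - e is a multiple of h, so e acts as the
    identity on I.\<close>
  define e where "e = k * a * g"
  have eI: "e \<in> I" using I_mult[OF g(1), of "k * a"] by (simp add: e_def mult_ac)
  have ec: "[e * c = c] (mod ?P)" if c: "c \<in> I" for c
  proof -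
    obtain c' where c': "c = g * c'" using g_dvd[OF c] by (auto elim: dvdE)
    have "e * c - 1 * c = - (k * b * h * c)"
      by (subst bezout) (simp add: e_def algebra_simps)
    also have "\<dots> = ?P * (- (k * b * c'))"
      by (simp add: h c' mult_ac)
    finally show ?thesis by (simp add: cong_iff_dvd_diff)
  qed
  note ee = ec[OF eI]
  \<comment> \<open>The involution sends this element of I to \<open>star m e\<close> times 1 - e,
    up to congruence, and 1 - e annihilates I; hence \<open>nondeg\<close> applies.\<close>
  have "[e - e * star m e = 0] (mod ?P)"
  proof (rule nondeg)
    have "e * (1 - star m e) \<in> I" using eI by (rule I_mult)
    thus "e - e * star m e \<in> I" by (simp add: algebra_simps)
    show "\<forall>c\<in>I. [c * star m (e - e * star m e) = 0] (mod ?P)"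
    proof
      fix c assume c: "c \<in> I"
      have "[c * star m e * star m (star m e) = c * star m e * e] (mod ?P)"
        using star_star[OF m] by (rule cong_scalar_left)
      also have "c * star m e * e = (e * c) * star m e" by (simp add: mult_ac)
      also have "[(e * c) * star m e = c * star m e] (mod ?P)"
        using ec[OF c] by (rule cong_scalar_right)
      finally have "[c * star m e * star m (star m e) = c * star m e] (mod ?P)" .
      from cong_diff[OF cong_refl[of "c * star m e"] this]
      show "[c * star m (e - e * star m e) = 0] (mod ?P)"
        by (simp add: star_diff star_mult algebra_simps)
    qed
  qed
  hence e_se: "[e = e * star m e] (mod ?P)"
    by (simp add: cong_diff_iff_cong_0)
  \<comment> \<open>The product e times \<open>star m e\<close> is invariant under the involution,
    so e, being congruent to it, is invariant too.\<close>
  have "[star m e = star m (e * star m e)] (mod ?P)"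
    using e_se by (rule star_cong)
  also have "star m (e * star m e) = star m e * star m (star m e)" by (rule star_mult)
  also have "[star m e * star m (star m e) = star m e * e] (mod ?P)"
    using star_star[OF m] by (rule cong_scalar_left)
  also have "star m e * e = e * star m e" by (rule mult.commute)
  also have "[e * star m e = e] (mod ?P)" using e_se by (rule cong_sym)
  finally have se: "[star m e = e] (mod ?P)" .
  let ?e = "e mod ?P"
  have e': "?e \<in> selfdual_idempotents m"
    using m ee se by (rule mod_circ_poly_in_selfdual_idempotents)
  hence ee': "[?e * ?e = ?e] (mod ?P)" by (simp add: selfdual_idempotents_def)
  have "poly_to_vec m f \<in> C \<longleftrightarrow> poly_to_vec m f \<in> idempotent_code m ?e" for f
  proof -
    have "[?e * f = e * f] (mod ?P)" by (intro cong_scalar_right) simp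
    hence "poly_to_vec m f \<in> idempotent_code m ?e \<longleftrightarrow> [e * f = f] (mod ?P)"
      unfolding poly_to_vec_in_idempotent_code[OF m ee'] by (simp add: cong_def)
    also have "\<dots> \<longleftrightarrow> f \<in> I"
      using ec I_cong[OF I_mult[OF eI]] by blast
    finally show ?thesis by (simp add: I_def)
  qed
  moreover have "C \<subseteq> carrier_vec m" using a_subset R by simp
  moreover have "idempotent_code m ?e \<subseteq> carrier_vec m"
    using cyclic_code_idempotent_code[of m ?e] R
    by (auto simp: cyclic_code_def dest!: ideal.Icarr)
  ultimately have "C = idempotent_code m ?e"
    by (blast elim: poly_to_vec_surj)
  with e' show ?thesis by (rule that)
qed

lemma card_hcd_cyclic_codes:
  assumes m: "m > 0"
  shows "card (hcd_cyclic_codes q m :: 'a vec set set) = card (selfdual_idempotents m)"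
proof -
  have "inj_on (idempotent_code m) (selfdual_idempotents m)"
  proof (rule inj_onI)
    fix e f assume ef: "e \<in> selfdual_idempotents m" "f \<in> selfdual_idempotents m"
      "idempotent_code m e = idempotent_code m f"
    hence idem: "[e * e = e] (mod circ_poly m)" "[f * f = f] (mod circ_poly m)"
      and deg: "degree e < m" "degree f < m"
      by (auto simp: selfdual_idempotents_def)
    \<comment> \<open>Each idempotent lies in the common code and acts there as the
      identity.\<close>
    have "[f * e = e] (mod circ_poly m)" "[e * f = f] (mod circ_poly m)"
      using idem ef(3) poly_to_vec_in_idempotent_code[OF m] by metis+
    hence "[e = f] (mod circ_poly m)"
      by (simp add: cong_def mult.commute)
    thus "e = f" using cong_iff_eq_of_degree_less[OF m deg] by simp
  qed
  moreover have "idempotent_code m ` selfdual_idempotents m = hcd_cyclic_codes q m"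
    using idempotent_code_hcd[OF m] hcd_cyclic_code_idempotent[OF m] by blast
  ultimately show ?thesis by (metis card_image)
qed

end

theorem corollary5p6:
  fixes p \<nu> n :: nat
  assumes "prime p" and "\<nu> > 0" and "n > 0" and "\<not> p dvd n"
    and "card (UNIV :: 'a :: {field, finite} set) = p ^ (2 * \<nu>)"
  shows "\<forall>k :: nat.
      card (hcd_cyclic_codes (p ^ \<nu>) (n * p ^ k) :: 'a vec set set)
        = card (hcd_cyclic_codes (p ^ \<nu>) n :: 'a vec set set)
    \<and> real (card (hcd_cyclic_codes (p ^ \<nu>) n :: 'a vec set set))
        = 2 powr
          ((\<Sum>d | d dvd n. real (lambda_ind d (p ^ \<nu>))
               * (real (totient d) / real (ord d (p ^ (2 * \<nu>)))))
         + 1 / 2 * (\<Sum>d | d dvd n. (1 - real (lambda_ind d (p ^ \<nu>)))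
               * (real (totient d) / real (ord d (p ^ (2 * \<nu>))))))"
proof -
  let ?q = "p ^ \<nu>"
  have Q: "p ^ (2 * \<nu>) = ?q\<^sup>2" by (simp add: power_mult mult.commute)
  \<comment> \<open>The characteristic is a prime dividing a power of p, hence equal to p.\<close>
  have "prime CHAR('a)"
    by (rule prime_CHAR_semidom) (rule finite_imp_CHAR_pos, simp)
  moreover have "CHAR('a) dvd p ^ (2 * \<nu>)"
    using CHAR_dvd_CARD[where 'a = 'a] assms(5) by simp
  ultimately have p: "CHAR('a) = p"
    using assms(1) prime_dvd_power primes_dvd_imp_eq by blast
  interpret hermitian_field ?q "TYPE('a)"
    by unfold_locales (use p assms(5) Q in auto)
  have cop: "coprime n ?q"
    using prime_imp_coprime[OF assms(1,4)] by (simp add: coprime_commute)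
  let ?M = "card (mult_orbits n ((n - 1) * ?q))"
  have cop_r: "coprime n ((n - 1) * ?q)"
    using cop assms(3) coprime_diff_one_right_nat by simp
  have "real ?M = (\<Sum>d | d dvd n. real (totient d) / real (ord d ((n - 1) * ?q)))"
    using assms(3) cop_r by (rule card_mult_orbits)
  also have "\<dots> = (\<Sum>d | d dvd n.
      real (lambda_ind d ?q) * (real (totient d) / real (ord d (?q\<^sup>2)))
      + 1 / 2 * ((1 - real (lambda_ind d ?q)) * (real (totient d) / real (ord d (?q\<^sup>2)))))"
  proof (rule sum.cong)
    \<comment> \<open>Where lambda is 0, the order of -q is twice that of q^2; this is the origin of
      the factor 1/2.\<close>
    fix d assume "d \<in> {d. d dvd n}"
    hence "ord d ((n - 1) * ?q) = (if lambda_ind d ?q = 1 then 1 else 2) * ord d (?q\<^sup>2)"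
      using ord_neg_mult[OF assms(3) cop] by simp
    thus "real (totient d) / real (ord d ((n - 1) * ?q)) =
        real (lambda_ind d ?q) * (real (totient d) / real (ord d (?q\<^sup>2)))
        + 1 / 2 * ((1 - real (lambda_ind d ?q)) * (real (totient d) / real (ord d (?q\<^sup>2))))"
      by (auto simp: lambda_ind_def)
  qed simp
  finally have M: "real ?M =
      (\<Sum>d | d dvd n. real (lambda_ind d ?q) * (real (totient d) / real (ord d (?q\<^sup>2))))
      + 1 / 2 * (\<Sum>d | d dvd n. (1 - real (lambda_ind d ?q)) * (real (totient d) / real (ord d (?q\<^sup>2))))"
    by (simp add: sum.distrib sum_distrib_left)
  have "card (hcd_cyclic_codes ?q (n * p ^ k) :: 'a vec set set)
      = card (hcd_cyclic_codes ?q n :: 'a vec set set)" for k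
    using card_selfdual_idempotents_CHAR_power[OF assms(3), of k] assms(1,3)
    by (simp add: card_hcd_cyclic_codes p prime_gt_0_nat)
  moreover have "real (card (hcd_cyclic_codes ?q n :: 'a vec set set)) = 2 powr real ?M"
    using card_selfdual_idempotents[OF assms(3) cop] assms(3)
    by (simp add: card_hcd_cyclic_codes powr_realpow)
  ultimately show ?thesis
    unfolding Q M[symmetric] by blast
qed

end
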